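(* For any set $S$ of positive integers of asymptotic density zero, the set $\mathcal{U}\cup S$ is not a union of finitely many infinite arithmetic progressions $\{m_ih+a_i : h=0,1,2,\dots\}$ (with $m_i,a_i$ positive integers) and a set of asymptotic density zero.
   Context: $\mathcal{U}$ denotes the set of positive odd integers $n$ that cannot be written as $n=p+2^k$ with $p$ a prime and $k$ a positive integer. A set $A$ of positive integers has asymptotic density $\delta$ if $|A\cap[1,x]|/x\to\delta$ as $x\to\infty$. *)

theory Defs
  imports Complex_Main "HOL-Computational_Algebra.Primes"
begin

definition has_asymp_density :: "nat set \<Rightarrow> real \<Rightarrow> bool" where
  "has_asymp_density A \<delta> \<longleftrightarrow>
     ((\<lambda>x::real. real (card {n \<in> A. 1 \<le> n \<and> real n \<le> x}) / x) \<longlongrightarrow> \<delta>) at_top"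

definition \<U> :: "nat set" where
  "\<U> = {n. 0 < n \<and> odd n \<and> \<not> (\<exists>p k. prime p \<and> 0 < k \<and> n = p + 2 ^ k)}"

definition arith_prog :: "nat \<Rightarrow> nat \<Rightarrow> nat set" where
  "arith_prog m a = {m * h + a | h. True}"

end

theory Submission
  imports Defs "HOL-Number_Theory.Number_Theory" "HOL-Analysis.Analysis" "HOL-Real_Asymp.Real_Asymp"
begin

text \<open>
  Let \<open>m\<close> be twice the product of the moduli. If every odd residue class modulo \<open>m\<close> met the
  progressions, almost all odd numbers would lie in \<open>\<U> \<union> S\<close>, contradicting Romanoff's theorem that the
  sums \<open>p + 2 ^ k\<close> have positive lower density. Otherwise some odd class \<open>a\<close> modulo \<open>m\<close> is disjoint
  from the progressions, and almost all of its elements are of the form \<open>p + 2 ^ k\<close>. For many primes \<open>l\<close>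
  choose a prime \<open>q l\<close> dividing \<open>2 ^ l - 1\<close>; fixing \<open>b\<close> suitably modulo the \<open>q l\<close> makes
  \<open>b - 2 ^ k\<close> divisible by some \<open>q l\<close> for all \<open>k\<close> outside a set of density \<open>\<Prod>(1 - 1 / l)\<close>, which can be
  made arbitrarily small. By the Brun-Titchmarsh bound the subclass of \<open>b\<close> then has too few elements
  \<open>p + 2 ^ k\<close>.

  Both ingredients rest on an upper bound sieve. Romanoff's theorem follows from the Cauchy-Schwarz
  inequality, the sieve bound for prime pairs with difference \<open>2 ^ k - 2 ^ l\<close>, and Erdos's proof that
  \<open>n / \<phi> n\<close> is bounded on average over \<open>n = 2 ^ j - 1\<close>.
\<close>

section \<open>Selberg weights on families of finite sets\<close>

lemma sum_prod_Pow:
  fixes f :: "'a \<Rightarrow> 'b :: comm_semiring_1"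
  assumes "finite A"
  shows "(\<Sum>X\<in>Pow A. \<Prod>x\<in>X. f x) = (\<Prod>x\<in>A. 1 + f x)"
  using prod_add[OF assms, of f "\<lambda>_. 1"] by (simp add: add.commute)

lemma sum_minus_one_power_card_between:
  assumes "finite E"
  shows "(\<Sum>D | T \<subseteq> D \<and> D \<subseteq> E. (-1) ^ card D) = (if T = E then (-1) ^ card T else (0 :: 'a :: ring_1))"
proof -
  consider "T \<subset> E" | "T = E" | "\<not> T \<subseteq> E" by blast
  then show ?thesis
  proof cases
    assume "T \<subset> E"
    then show ?thesis
      using assms card_subsupersets_even_odd[OF assms \<open>T \<subset> E\<close>]
      by (auto intro!: sum_alternating_cancels simp: conj_ac)
  next
    assume "T = E"
    then have "{D. T \<subseteq> D \<and> D \<subseteq> E} = {E}" by auto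
    then show ?thesis using \<open>T = E\<close> by simp
  next
    assume "\<not> T \<subseteq> E"
    then have "{D. T \<subseteq> D \<and> D \<subseteq> E} = {}" "T \<noteq> E" by auto
    then show ?thesis by (simp only: sum.empty if_False)
  qed
qed

lemma sum_power2_sum_subsets:
  fixes w :: "'a set \<Rightarrow> real"
  assumes "finite A" "finite \<D>"
  shows "(\<Sum>n\<in>A. (\<Sum>D | D \<in> \<D> \<and> D \<subseteq> B n. w D)\<^sup>2)
    = (\<Sum>D\<in>\<D>. \<Sum>E\<in>\<D>. w D * w E * real (card {n \<in> A. D \<union> E \<subseteq> B n}))"
proof -
  have "(\<Sum>D | D \<in> \<D> \<and> D \<subseteq> B n. w D)\<^sup>2 = (\<Sum>D\<in>\<D>. \<Sum>E\<in>\<D>. if D \<union> E \<subseteq> B n then w D * w E else 0)"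
    for n
  proof -
    have "(\<Sum>D | D \<in> \<D> \<and> D \<subseteq> B n. w D) = (\<Sum>D\<in>\<D>. if D \<subseteq> B n then w D else 0)"
      using assms(2) by (simp add: sum.inter_filter)
    then show ?thesis
      unfolding power2_eq_square by (simp only: sum_product) (auto intro!: sum.cong)
  qed
  then have "(\<Sum>n\<in>A. (\<Sum>D | D \<in> \<D> \<and> D \<subseteq> B n. w D)\<^sup>2)
      = (\<Sum>n\<in>A. \<Sum>D\<in>\<D>. \<Sum>E\<in>\<D>. if D \<union> E \<subseteq> B n then w D * w E else 0)" by simp
  also have "\<dots> = (\<Sum>D\<in>\<D>. \<Sum>n\<in>A. \<Sum>E\<in>\<D>. if D \<union> E \<subseteq> B n then w D * w E else 0)"
    by (rule sum.swap)
  also have "\<dots> = (\<Sum>D\<in>\<D>. \<Sum>E\<in>\<D>. \<Sum>n\<in>A. if D \<union> E \<subseteq> B n then w D * w E else 0)"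
    by (intro sum.cong refl sum.swap)
  also have "\<dots> = (\<Sum>D\<in>\<D>. \<Sum>E\<in>\<D>. w D * w E * real (card {n \<in> A. D \<union> E \<subseteq> B n}))"
    using assms(1) by (intro sum.cong refl) (simp add: mult.commute flip: sum.inter_filter)
  finally show ?thesis .
qed

locale selberg_weights =
  fixes \<D> :: "'a set set" and g :: "'a \<Rightarrow> real"
  assumes finite_family: "finite \<D>" and nonempty_family: "\<D> \<noteq> {}"
    and subset_closed: "D \<in> \<D> \<Longrightarrow> E \<subseteq> D \<Longrightarrow> E \<in> \<D>"
    and density_bounds: "D \<in> \<D> \<Longrightarrow> q \<in> D \<Longrightarrow> 0 < g q \<and> g q < 1"
begin

definition joint_density :: "'a set \<Rightarrow> real" where
  "joint_density D = (\<Prod>q\<in>D. g q)"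

definition dual_density :: "'a set \<Rightarrow> real" where
  "dual_density D = (\<Prod>q\<in>D. g q / (1 - g q))"

definition dual_total :: real where
  "dual_total = (\<Sum>D\<in>\<D>. dual_density D)"

text \<open>The minimizer of the quadratic form in \<open>quadratic_form_weight\<close> among all \<open>w\<close> with \<open>w {} = 1\<close>.\<close>

definition weight :: "'a set \<Rightarrow> real" where
  "weight D = (-1) ^ card D / joint_density D * ((\<Sum>E | E \<in> \<D> \<and> D \<subseteq> E. dual_density E) / dual_total)"

lemma empty_mem: "{} \<in> \<D>"
  using nonempty_family subset_closed by blast

lemma finite_mem: "D \<in> \<D> \<Longrightarrow> finite D"
  using finite_subset[OF _ finite_family, of "Pow D"] subset_closed by auto

lemma joint_density_pos: "D \<in> \<D> \<Longrightarrow> joint_density D > 0"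
  using density_bounds by (auto simp: joint_density_def intro!: prod_pos)

lemma dual_density_pos: "D \<in> \<D> \<Longrightarrow> dual_density D > 0"
  using density_bounds by (auto simp: dual_density_def intro!: prod_pos)

lemma dual_total_pos: "dual_total > 0"
  unfolding dual_total_def using nonempty_family by (intro sum_pos finite_family dual_density_pos)

lemma weight_empty: "weight {} = 1"
  using dual_total_pos by (simp add: weight_def joint_density_def dual_total_def)

lemma abs_weight_le:
  assumes "D \<in> \<D>"
  shows "\<bar>weight D\<bar> \<le> 1 / joint_density D"
proof -
  let ?s = "\<Sum>E | E \<in> \<D> \<and> D \<subseteq> E. dual_density E"
  have "0 \<le> ?s"
    by (intro sum_nonneg) (auto intro: less_imp_le dual_density_pos)
  moreover have "?s \<le> dual_total"
    unfolding dual_total_def by (intro sum_mono2 finite_family) (auto intro: less_imp_le dual_density_pos)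
  ultimately have "\<bar>?s / dual_total\<bar> \<le> 1" using dual_total_pos by simp
  then have "1 / joint_density D * \<bar>?s / dual_total\<bar> \<le> 1 / joint_density D * 1"
    using joint_density_pos[OF assms] by (intro mult_left_mono) auto
  then show ?thesis
    using joint_density_pos[OF assms] by (simp add: weight_def abs_mult power_abs)
qed

lemma sum_inverse_dual_density_Pow:
  assumes "D \<in> \<D>"
  shows "(\<Sum>T\<in>Pow D. 1 / dual_density T) = 1 / joint_density D"
proof -
  have "(\<Sum>T\<in>Pow D. 1 / dual_density T) = (\<Prod>q\<in>D. 1 + (1 - g q) / g q)"
    using sum_prod_Pow[OF finite_mem[OF assms], of "\<lambda>q. (1 - g q) / g q"]
    by (simp add: dual_density_def prod_dividef)
  also have "\<dots> = (\<Prod>q\<in>D. 1 / g q)"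
  proof (intro prod.cong refl)
    fix q assume "q \<in> D"
    then show "1 + (1 - g q) / g q = 1 / g q"
      using density_bounds[OF assms] by (fastforce simp: field_simps)
  qed
  finally show ?thesis by (simp add: joint_density_def prod_dividef)
qed

lemma joint_density_Un:
  assumes "D \<in> \<D>" "E \<in> \<D>"
  shows "joint_density (D \<union> E) = joint_density D * joint_density E * (\<Sum>T\<in>Pow (D \<inter> E). 1 / dual_density T)"
proof -
  have inter: "D \<inter> E \<in> \<D>" using assms subset_closed by blast
  have "joint_density (D \<union> E) * joint_density (D \<inter> E) = joint_density D * joint_density E"
    unfolding joint_density_def using assms finite_mem by (intro prod.union_inter) auto
  then show ?thesis
    unfolding sum_inverse_dual_density_Pow[OF inter]
    using joint_density_pos[OF inter] by (simp add: field_simps)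
qed

lemma quadratic_form_diagonal:
  fixes w :: "'a set \<Rightarrow> real"
  shows "(\<Sum>D\<in>\<D>. \<Sum>E\<in>\<D>. w D * w E * joint_density (D \<union> E))
    = (\<Sum>T\<in>\<D>. (\<Sum>D | D \<in> \<D> \<and> T \<subseteq> D. joint_density D * w D)\<^sup>2 / dual_density T)"
proof -
  define v where "v T D = (if T \<subseteq> D then joint_density D * w D else 0)" for T D
  have "(\<Sum>D\<in>\<D>. \<Sum>E\<in>\<D>. w D * w E * joint_density (D \<union> E))
      = (\<Sum>D\<in>\<D>. \<Sum>E\<in>\<D>. \<Sum>T\<in>\<D>. v T D * v T E / dual_density T)"
  proof (intro sum.cong refl)
    fix D E assume D: "D \<in> \<D>" and E: "E \<in> \<D>"
    have "{T \<in> \<D>. T \<subseteq> D \<and> T \<subseteq> E} = Pow (D \<inter> E)" using D E subset_closed by auto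
    then have "w D * w E * joint_density (D \<union> E)
        = (\<Sum>T | T \<in> \<D> \<and> T \<subseteq> D \<and> T \<subseteq> E. joint_density D * w D * (joint_density E * w E) / dual_density T)"
      by (simp only: joint_density_Un[OF D E] sum_distrib_left) (simp add: mult_ac)
    also have "\<dots> = (\<Sum>T\<in>\<D>. v T D * v T E / dual_density T)"
      by (simp only: sum.inter_filter[OF finite_family]) (intro sum.cong refl, simp add: v_def)
    finally show "w D * w E * joint_density (D \<union> E) = (\<Sum>T\<in>\<D>. v T D * v T E / dual_density T)" .
  qed
  also have "\<dots> = (\<Sum>D\<in>\<D>. \<Sum>T\<in>\<D>. \<Sum>E\<in>\<D>. v T D * v T E / dual_density T)"
    by (intro sum.cong refl sum.swap)
  also have "\<dots> = (\<Sum>T\<in>\<D>. \<Sum>D\<in>\<D>. \<Sum>E\<in>\<D>. v T D * v T E / dual_density T)"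
    by (rule sum.swap)
  also have "\<dots> = (\<Sum>T\<in>\<D>. (\<Sum>D\<in>\<D>. v T D)\<^sup>2 / dual_density T)"
    by (simp add: power2_eq_square sum_product sum_divide_distrib)
  finally show ?thesis
    using finite_family by (simp add: v_def sum.inter_filter)
qed

lemma sum_supersets_joint_density_weight:
  assumes T: "T \<in> \<D>"
  shows "(\<Sum>D | D \<in> \<D> \<and> T \<subseteq> D. joint_density D * weight D) = (-1) ^ card T * dual_density T / dual_total"
proof -
  have "(\<Sum>D | D \<in> \<D> \<and> T \<subseteq> D. joint_density D * weight D)
      = (\<Sum>D | D \<in> \<D> \<and> T \<subseteq> D. \<Sum>E | E \<in> \<D> \<and> D \<subseteq> E. (-1) ^ card D * dual_density E / dual_total)"
  proof (intro sum.cong refl)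
    fix D assume "D \<in> {D. D \<in> \<D> \<and> T \<subseteq> D}"
    then have "joint_density D > 0" using joint_density_pos by auto
    then show "joint_density D * weight D = (\<Sum>E | E \<in> \<D> \<and> D \<subseteq> E. (-1) ^ card D * dual_density E / dual_total)"
      by (simp add: weight_def sum_distrib_left sum_divide_distrib)
  qed
  also have "\<dots> = (\<Sum>E\<in>\<D>. \<Sum>D | D \<in> {D \<in> \<D>. T \<subseteq> D} \<and> D \<subseteq> E. (-1) ^ card D * dual_density E / dual_total)"
    using finite_family by (subst sum.swap_restrict) auto
  also have "\<dots> = (\<Sum>E\<in>\<D>. if T = E then (-1) ^ card T * dual_density E / dual_total else 0)"
  proof (intro sum.cong refl)
    fix E assume E: "E \<in> \<D>"
    have "{D. D \<in> {D \<in> \<D>. T \<subseteq> D} \<and> D \<subseteq> E} = {D. T \<subseteq> D \<and> D \<subseteq> E}"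
      using E subset_closed by auto
    then show "(\<Sum>D | D \<in> {D \<in> \<D>. T \<subseteq> D} \<and> D \<subseteq> E. (-1) ^ card D * dual_density E / dual_total)
        = (if T = E then (-1) ^ card T * dual_density E / dual_total else 0)"
      using sum_minus_one_power_card_between[OF finite_mem[OF E], of T, where 'a = real]
      by (simp flip: sum_divide_distrib sum_distrib_right)
  qed
  also have "\<dots> = (-1) ^ card T * dual_density T / dual_total"
    using finite_family T by simp
  finally show ?thesis .
qed

lemma quadratic_form_weight:
  "(\<Sum>D\<in>\<D>. \<Sum>E\<in>\<D>. weight D * weight E * joint_density (D \<union> E)) = 1 / dual_total"
proof -
  have "(\<Sum>D\<in>\<D>. \<Sum>E\<in>\<D>. weight D * weight E * joint_density (D \<union> E))
      = (\<Sum>T\<in>\<D>. ((-1) ^ card T * dual_density T / dual_total)\<^sup>2 / dual_density T)"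
    by (simp add: quadratic_form_diagonal sum_supersets_joint_density_weight)
  also have "\<dots> = (\<Sum>T\<in>\<D>. dual_density T / dual_total\<^sup>2)"
  proof (intro sum.cong refl)
    fix T assume "T \<in> \<D>"
    then show "((-1) ^ card T * dual_density T / dual_total)\<^sup>2 / dual_density T = dual_density T / dual_total\<^sup>2"
      using dual_density_pos[of T]
      by (simp add: power_mult_distrib power_divide power2_eq_square[of "dual_density T"] flip: power_mult)
  qed
  also have "\<dots> = 1 / dual_total"
    using dual_total_pos by (simp add: power2_eq_square flip: sum_divide_distrib dual_total_def)
  finally show ?thesis .
qed

theorem card_sifted_le:
  fixes X :: real and \<rho> :: "'a set \<Rightarrow> real"
  assumes A: "finite A"
    and remainder: "\<And>D E. D \<in> \<D> \<Longrightarrow> E \<in> \<D> \<Longrightarrow>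
      \<bar>real (card {n \<in> A. D \<union> E \<subseteq> B n}) - X * joint_density (D \<union> E)\<bar> \<le> \<rho> (D \<union> E)"
  shows "real (card {n \<in> A. B n = {}})
    \<le> X / dual_total + (\<Sum>D\<in>\<D>. \<Sum>E\<in>\<D>. \<rho> (D \<union> E) / (joint_density D * joint_density E))"
proof -
  have "real (card {n \<in> A. B n = {}}) = (\<Sum>n\<in>A. if B n = {} then 1 else 0)"
    using A by (simp add: sum.If_cases Int_def)
  also have "\<dots> \<le> (\<Sum>n\<in>A. (\<Sum>D | D \<in> \<D> \<and> D \<subseteq> B n. weight D)\<^sup>2)"
  proof (intro sum_mono)
    fix n
    have "{D. D \<in> \<D> \<and> D \<subseteq> B n} = {{}}" if "B n = {}" using that empty_mem by auto
    then show "(if B n = {} then 1 else 0) \<le> (\<Sum>D | D \<in> \<D> \<and> D \<subseteq> B n. weight D)\<^sup>2"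
      using weight_empty by auto
  qed
  also have "\<dots> = (\<Sum>D\<in>\<D>. \<Sum>E\<in>\<D>. weight D * weight E * real (card {n \<in> A. D \<union> E \<subseteq> B n}))"
    using A finite_family by (rule sum_power2_sum_subsets)
  also have "\<dots> \<le> (\<Sum>D\<in>\<D>. \<Sum>E\<in>\<D>.
      X * (weight D * weight E * joint_density (D \<union> E)) + \<rho> (D \<union> E) / (joint_density D * joint_density E))"
  proof (intro sum_mono)
    fix D E assume D: "D \<in> \<D>" and E: "E \<in> \<D>"
    let ?r = "real (card {n \<in> A. D \<union> E \<subseteq> B n}) - X * joint_density (D \<union> E)"
    have "weight D * weight E * ?r \<le> \<bar>weight D\<bar> * \<bar>weight E\<bar> * \<bar>?r\<bar>"
      using abs_ge_self[of "weight D * weight E * ?r"] by (simp only: abs_mult)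
    also have "\<dots> \<le> 1 / joint_density D * (1 / joint_density E) * \<rho> (D \<union> E)"
      using joint_density_pos[OF D] joint_density_pos[OF E]
      by (intro mult_mono abs_weight_le remainder D E) auto
    finally show "weight D * weight E * real (card {n \<in> A. D \<union> E \<subseteq> B n})
        \<le> X * (weight D * weight E * joint_density (D \<union> E)) + \<rho> (D \<union> E) / (joint_density D * joint_density E)"
      by (simp add: algebra_simps)
  qed
  also have "\<dots> = X / dual_total + (\<Sum>D\<in>\<D>. \<Sum>E\<in>\<D>. \<rho> (D \<union> E) / (joint_density D * joint_density E))"
    by (simp only: sum.distrib sum_distrib_left[symmetric] quadratic_form_weight) simp
  finally show ?thesis .
qed

end

section \<open>Counting in residue classes\<close>

lemma card_residue_class_less:
  fixes d N r :: nat
  assumes "r < d"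
  shows "\<bar>real (card {n. n < N \<and> n mod d = r}) - real N / real d\<bar> \<le> 1"
proof -
  let ?S = "{n. n < N \<and> n mod d = r}" and ?f = "\<lambda>i. d * i + r" and ?t = "N div d"
  have N: "d * ?t \<le> N" "N < d * (?t + 1)"
    using assms by (auto simp: dividend_less_times_div)
  have card_image: "card (?f ` A) = card A" for A
    using assms by (intro card_image) (auto intro!: inj_onI)
  have "?f ` {..<?t} \<subseteq> ?S"
  proof safe
    fix i assume "i < ?t"
    then have "d * (i + 1) \<le> d * ?t" by (intro mult_le_mono2) simp
    moreover have "d * i + r < d * (i + 1)" using assms by simp
    ultimately show "d * i + r < N" using N(1) by linarith
  qed (use assms in simp)
  then have lower: "?t \<le> card ?S"
    using card_mono[of ?S "?f ` {..<?t}"] by (simp add: card_image)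
  have "?S \<subseteq> ?f ` {..<?t + 1}"
  proof
    fix n assume n: "n \<in> ?S"
    then have "n = d * (n div d) + r" by auto
    moreover have "n div d < ?t + 1"
      using n N(2) by (auto simp: less_mult_imp_div_less mult.commute)
    ultimately show "n \<in> ?f ` {..<?t + 1}" by blast
  qed
  then have upper: "card ?S \<le> ?t + 1"
    using card_mono[of "?f ` {..<?t + 1}" ?S] by (simp add: card_image)
  have "real ?t \<le> real N / real d" by (rule of_nat_div_le_of_nat)
  moreover have "real N \<le> real (d * (?t + 1))" using N(2) by (simp only: of_nat_le_iff less_imp_le)
  then have "real N / real d \<le> real ?t + 1" using assms by (simp add: field_simps)
  ultimately show ?thesis using lower upper by linarith
qed

lemma card_residue_classes_less:
  fixes d N :: nat
  assumes "W \<subseteq> {..<d}"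
  shows "\<bar>real (card {n. n < N \<and> n mod d \<in> W}) - real (card W) * (real N / real d)\<bar> \<le> card W"
proof -
  have "finite W" using assms finite_subset by blast
  moreover have "{n. n < N \<and> n mod d \<in> W} = (\<Union>r\<in>W. {n. n < N \<and> n mod d = r})" by auto
  ultimately have "card {n. n < N \<and> n mod d \<in> W} = (\<Sum>r\<in>W. card {n. n < N \<and> n mod d = r})"
    by (simp only:) (intro card_UN_disjoint, auto)
  then have "real (card {n. n < N \<and> n mod d \<in> W}) - real (card W) * (real N / real d)
      = (\<Sum>r\<in>W. real (card {n. n < N \<and> n mod d = r}) - real N / real d)"
    by (simp add: sum_subtractf)
  also have "\<bar>\<dots>\<bar> \<le> (\<Sum>r\<in>W. \<bar>real (card {n. n < N \<and> n mod d = r}) - real N / real d\<bar>)"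
    by (rule sum_abs)
  also have "\<dots> \<le> (\<Sum>r\<in>W. 1)"
    using assms by (intro sum_mono card_residue_class_less) auto
  finally show ?thesis by simp
qed

lemma bij_betw_residues:
  fixes D :: "nat set"
  assumes "finite D" and coprime: "\<And>p q. p \<in> D \<Longrightarrow> q \<in> D \<Longrightarrow> p \<noteq> q \<Longrightarrow> coprime p q"
  shows "bij_betw (\<lambda>n. restrict (\<lambda>q. n mod q) D) {..<\<Prod>D} (PiE D (\<lambda>q. {..<q}))"
proof (cases "0 \<in> D")
  case True
  then have "\<Prod>D = 0" using assms(1) by simp
  then show ?thesis using True by (auto simp: bij_betw_def PiE_eq_empty_iff)
next
  case False
  let ?f = "\<lambda>n. restrict (\<lambda>q. n mod q) D"
  have inj: "inj_on ?f {..<\<Prod>D}"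
  proof
    fix m n assume less: "m \<in> {..<\<Prod>D}" "n \<in> {..<\<Prod>D}" and eq: "?f m = ?f n"
    have "[m = n] (mod q)" if "q \<in> D" for q
      using fun_cong[OF eq, of q] that by (simp add: Cong.cong_def)
    then have "[m = n] (mod \<Prod>D)" by (intro coprime_cong_prod_nat coprime)
    then show "m = n" using less cong_less_modulus_unique_nat by auto
  qed
  have "?f ` {..<\<Prod>D} \<subseteq> PiE D (\<lambda>q. {..<q})" using False by (auto intro!: mod_less_divisor Nat.gr0I)
  moreover have "card (?f ` {..<\<Prod>D}) = card (PiE D (\<lambda>q. {..<q}))"
    using assms(1) by (simp add: card_image[OF inj] card_PiE)
  ultimately have "?f ` {..<\<Prod>D} = PiE D (\<lambda>q. {..<q})"
    using assms(1) by (intro card_subset_eq finite_PiE) auto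
  with inj show ?thesis by (simp add: bij_betw_def)
qed

lemma card_residue_vectors:
  fixes D :: "nat set" and \<Omega> :: "nat \<Rightarrow> nat set"
  assumes D: "finite D" "\<And>p q. p \<in> D \<Longrightarrow> q \<in> D \<Longrightarrow> p \<noteq> q \<Longrightarrow> coprime p q"
    and \<Omega>: "\<And>q. q \<in> D \<Longrightarrow> \<Omega> q \<subseteq> {..<q}"
  shows "card {n. n < \<Prod>D \<and> (\<forall>q\<in>D. n mod q \<in> \<Omega> q)} = (\<Prod>q\<in>D. card (\<Omega> q))"
proof -
  let ?f = "\<lambda>n. restrict (\<lambda>q. n mod q) D" and ?S = "{n. n < \<Prod>D \<and> (\<forall>q\<in>D. n mod q \<in> \<Omega> q)}"
  have bij: "bij_betw ?f {..<\<Prod>D} (PiE D (\<lambda>q. {..<q}))" using D by (rule bij_betw_residues)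
  have image_restrict: "F ` {n \<in> A. F n \<in> V} = V" if "V \<subseteq> F ` A" for A V and F :: "nat \<Rightarrow> nat \<Rightarrow> nat"
    using that by auto
  have "?S = {n \<in> {..<\<Prod>D}. ?f n \<in> PiE D \<Omega>}" by auto
  moreover have "PiE D \<Omega> \<subseteq> ?f ` {..<\<Prod>D}"
    unfolding bij_betw_imp_surj_on[OF bij] by (intro PiE_mono \<Omega>)
  ultimately have "?f ` ?S = PiE D \<Omega>" using image_restrict by (simp only:)
  then have "bij_betw ?f ?S (PiE D \<Omega>)" by (intro bij_betw_subset[OF bij]) auto
  then show ?thesis using D(1) by (simp add: bij_betw_same_card card_PiE)
qed

lemma card_residue_vectors_less:
  fixes D :: "nat set" and \<Omega> :: "nat \<Rightarrow> nat set"
  assumes D: "finite D" "\<And>p q. p \<in> D \<Longrightarrow> q \<in> D \<Longrightarrow> p \<noteq> q \<Longrightarrow> coprime p q"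
    and \<Omega>: "\<And>q. q \<in> D \<Longrightarrow> \<Omega> q \<subseteq> {..<q}" and "0 \<notin> D"
  shows "\<bar>real (card {n. n < N \<and> (\<forall>q\<in>D. n mod q \<in> \<Omega> q)}) - real N * (\<Prod>q\<in>D. real (card (\<Omega> q)) / real q)\<bar>
    \<le> (\<Prod>q\<in>D. real (card (\<Omega> q)))"
proof -
  let ?W = "{n. n < \<Prod>D \<and> (\<forall>q\<in>D. n mod q \<in> \<Omega> q)}"
  have "\<Prod>D > 0" using D(1) \<open>0 \<notin> D\<close> by (intro Nat.gr0I) simp
  moreover have "n mod \<Prod>D mod q = n mod q" if "q \<in> D" for n q
    using dvd_prodI[OF D(1) that, of "\<lambda>x. x"] by (simp add: mod_mod_cancel)
  ultimately have "{n. n < N \<and> (\<forall>q\<in>D. n mod q \<in> \<Omega> q)} = {n. n < N \<and> n mod \<Prod>D \<in> ?W}" by auto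
  moreover have "\<bar>real (card {n. n < N \<and> n mod \<Prod>D \<in> ?W}) - real (card ?W) * (real N / real (\<Prod>D))\<bar> \<le> card ?W"
    by (rule card_residue_classes_less) auto
  ultimately show ?thesis
    by (simp add: card_residue_vectors[OF D \<Omega>] prod_dividef mult.commute[of "real N"])
qed

section \<open>Truncated Euler products\<close>

lemma prod_Un_le:
  fixes f :: "'a \<Rightarrow> 'b :: linordered_semidom"
  assumes "finite A" "finite B" "\<And>x. x \<in> A \<union> B \<Longrightarrow> 1 \<le> f x"
  shows "prod f (A \<union> B) \<le> prod f A * prod f B"
proof -
  have "1 \<le> prod f (A \<inter> B)" "1 \<le> prod f (A \<union> B)" using assms(3) by (auto intro!: prod_ge_1)
  then have "prod f (A \<union> B) * 1 \<le> prod f (A \<union> B) * prod f (A \<inter> B)"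
    by (intro mult_left_mono) (auto intro: order_trans[OF zero_le_one])
  then show ?thesis using assms by (simp add: prod.union_inter)
qed

lemma prod_subset_le:
  fixes f :: "'a \<Rightarrow> 'b :: linordered_idom"
  assumes "finite B" "A \<subseteq> B" "\<And>x. x \<in> B \<Longrightarrow> 1 \<le> f x"
  shows "prod f A \<le> prod f B"
  using assms by (intro prod_mono2) (auto intro!: order_trans[OF zero_le_one])

text \<open>A squarefree number is represented by the set of its prime factors, so that divisibility, gcd and
  lcm become inclusion, intersection and union.\<close>

definition subsets_prod_le :: "nat set \<Rightarrow> real \<Rightarrow> nat set set" where
  "subsets_prod_le P z = {D. D \<subseteq> P \<and> (\<Prod>q\<in>D. real q) \<le> z}"

definition truncated_euler_product :: "(nat \<Rightarrow> real) \<Rightarrow> nat set \<Rightarrow> real \<Rightarrow> real" where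
  "truncated_euler_product h P z = (\<Sum>D\<in>subsets_prod_le P z. \<Prod>q\<in>D. h q)"

lemma subsets_prod_leD:
  "D \<in> subsets_prod_le P z \<Longrightarrow> D \<subseteq> P"
  "D \<in> subsets_prod_le P z \<Longrightarrow> (\<Prod>q\<in>D. real q) \<le> z"
  by (auto simp: subsets_prod_le_def)

lemma finite_subsets_prod_le: "finite P \<Longrightarrow> finite (subsets_prod_le P z)"
  by (rule finite_subset[of _ "Pow P"]) (auto simp: subsets_prod_le_def)

lemma finite_mem_subsets_prod_le: "finite P \<Longrightarrow> D \<in> subsets_prod_le P z \<Longrightarrow> finite D"
  by (auto simp: subsets_prod_le_def intro: finite_subset)

lemma subset_mem_subsets_prod_le:
  assumes "finite P" "0 \<notin> P" "D \<in> subsets_prod_le P z" "E \<subseteq> D"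
  shows "E \<in> subsets_prod_le P z"
proof -
  have "(\<Prod>q\<in>E. real q) \<le> (\<Prod>q\<in>D. real q)"
    using assms finite_mem_subsets_prod_le[OF assms(1,3)]
    by (intro prod_subset_le) (auto simp: Suc_le_eq subsets_prod_le_def intro!: Nat.gr0I)
  then show ?thesis using assms(3,4) by (auto simp: subsets_prod_le_def)
qed

lemma inj_on_prod_primes:
  "inj_on (\<lambda>D. \<Prod>D) {D :: nat set. finite D \<and> (\<forall>q\<in>D. prime q)}"
proof (rule inj_on_inverseI[where g = prime_factors])
  fix D :: "nat set" assume "D \<in> {D. finite D \<and> (\<forall>q\<in>D. prime q)}"
  then have D: "finite D" "\<And>q. q \<in> D \<Longrightarrow> prime q" by auto
  have "prime_factors (\<Prod>D) = (\<Union>q\<in>D. prime_factors q)"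
    using D by (subst prime_factors_prod) (auto dest: D(2))
  also have "\<dots> = (\<Union>q\<in>D. {q})" using D by (auto simp: prime_prime_factors)
  finally show "prime_factors (\<Prod>D) = D" by simp
qed

lemma card_subsets_prod_le:
  assumes P: "finite P" "\<And>q. q \<in> P \<Longrightarrow> prime q" and "z \<ge> 0"
  shows "real (card (subsets_prod_le P z)) \<le> z"
proof -
  have "card (subsets_prod_le P z) \<le> card {1..nat \<lfloor>z\<rfloor>}"
  proof (rule card_inj_on_le[where f = "\<lambda>D. \<Prod>D"])
    show "inj_on (\<lambda>D. \<Prod>D) (subsets_prod_le P z)"
      using inj_on_prod_primes
      by (rule inj_on_subset) (use P in \<open>auto simp: subsets_prod_le_def intro: finite_subset\<close>)
    show "(\<lambda>D. \<Prod>D) ` subsets_prod_le P z \<subseteq> {1..nat \<lfloor>z\<rfloor>}"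
    proof safe
      fix D assume D: "D \<in> subsets_prod_le P z"
      then have "\<Prod>D > 0"
        using P(2) by (intro prod_pos) (auto simp: subsets_prod_le_def intro!: prime_gt_0_nat)
      moreover have "real (\<Prod>D) \<le> z" using subsets_prod_leD(2)[OF D] by simp
      ultimately show "\<Prod>D \<in> {1..nat \<lfloor>z\<rfloor>}" by (simp add: le_nat_floor)
    qed
  qed simp
  then show ?thesis using \<open>z \<ge> 0\<close> by (simp add: le_nat_iff le_floor_iff)
qed

lemma truncated_euler_product_mono:
  assumes "\<And>q. q \<in> P \<Longrightarrow> 0 \<le> h q \<and> h q \<le> k q"
  shows "truncated_euler_product h P z \<le> truncated_euler_product k P z"
  unfolding truncated_euler_product_def
  using assms by (intro sum_mono prod_mono) (auto simp: subsets_prod_le_def)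

lemma truncated_euler_product_nonneg:
  assumes "\<And>q. q \<in> P \<Longrightarrow> 0 \<le> h q"
  shows "0 \<le> truncated_euler_product h P z"
  unfolding truncated_euler_product_def
  using assms by (intro sum_nonneg prod_nonneg) (auto simp: subsets_prod_le_def)

lemma truncated_euler_product_le_prod:
  assumes "finite P" "\<And>q. q \<in> P \<Longrightarrow> 0 \<le> h q"
  shows "truncated_euler_product h P z \<le> (\<Prod>q\<in>P. 1 + h q)"
proof -
  have "truncated_euler_product h P z \<le> (\<Sum>D\<in>Pow P. \<Prod>q\<in>D. h q)"
    unfolding truncated_euler_product_def using assms
    by (intro sum_mono2 prod_nonneg) (auto dest: subsets_prod_leD(1))
  then show ?thesis using assms(1) by (simp add: sum_prod_Pow)
qed

lemma truncated_euler_product_Diff: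
  assumes "finite P"
  shows "truncated_euler_product h (P - R) z = truncated_euler_product (\<lambda>q. if q \<in> R then 0 else h q) P z"
  unfolding truncated_euler_product_def
proof (intro sum.mono_neutral_cong_left ballI)
  show "finite (subsets_prod_le P z)" using assms by (rule finite_subsets_prod_le)
  show "subsets_prod_le (P - R) z \<subseteq> subsets_prod_le P z" by (auto simp: subsets_prod_le_def)
next
  fix D assume D: "D \<in> subsets_prod_le P z - subsets_prod_le (P - R) z"
  then have "D \<in> subsets_prod_le P z" by blast
  then have "finite D" by (rule finite_mem_subsets_prod_le[OF assms])
  moreover obtain q where "q \<in> D" "q \<in> R" using D by (auto simp: subsets_prod_le_def)
  ultimately show "(\<Prod>q\<in>D. if q \<in> R then 0 else h q) = 0" by (intro prod_zero bexI[of _ q]) auto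
next
  fix D assume "D \<in> subsets_prod_le (P - R) z"
  then show "(\<Prod>q\<in>D. h q) = (\<Prod>q\<in>D. if q \<in> R then 0 else h q)"
    by (intro prod.cong) (auto dest: subsets_prod_leD(1))
qed

lemma truncated_euler_product_le_Diff:
  assumes P: "finite P" "0 \<notin> P" and h: "\<And>q. q \<in> P \<Longrightarrow> 0 \<le> h q"
  shows "truncated_euler_product h P z \<le> (\<Prod>q\<in>P \<inter> R. 1 + h q) * truncated_euler_product h (P - R) z"
proof -
  let ?S = "subsets_prod_le (P - R) z"
  have "finite (P \<inter> R)" using P(1) by simp
  have "truncated_euler_product h P z \<le> (\<Sum>(X, D)\<in>Pow (P \<inter> R) \<times> ?S. prod h X * prod h D)"
    unfolding truncated_euler_product_def
  proof (rule sum_le_included[where i = "\<lambda>(X, D). X \<union> D"], safe)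
    fix D assume D: "D \<in> subsets_prod_le P z"
    have "D - R \<in> subsets_prod_le P z" using subset_mem_subsets_prod_le[OF P D] by blast
    then have "(D \<inter> R, D - R) \<in> Pow (P \<inter> R) \<times> ?S" using D by (auto simp: subsets_prod_le_def)
    moreover have "prod h D = prod h (D \<inter> R) * prod h (D - R)"
      using finite_mem_subsets_prod_le[OF P(1) D] by (rule prod.Int_Diff)
    ultimately show "\<exists>y\<in>Pow (P \<inter> R) \<times> ?S. (case y of (X, D) \<Rightarrow> X \<union> D) = D \<and>
        prod h D \<le> (case y of (X, D) \<Rightarrow> prod h X * prod h D)"
      by (intro bexI[of _ "(D \<inter> R, D - R)"]) auto
  next
    fix X D assume "X \<subseteq> P \<inter> R" "D \<in> ?S"
    then show "0 \<le> prod h X * prod h D"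
      using h by (intro mult_nonneg_nonneg prod_nonneg) (auto dest: subsets_prod_leD(1))
  qed (use P(1) in \<open>auto intro!: finite_cartesian_product finite_subsets_prod_le\<close>)
  also have "\<dots> = (\<Prod>q\<in>P \<inter> R. 1 + h q) * truncated_euler_product h (P - R) z"
    by (simp add: truncated_euler_product_def sum_prod_Pow[OF \<open>finite (P \<inter> R)\<close>, symmetric]
        sum_product sum.cartesian_product)
  finally show ?thesis .
qed

lemma sum_prod_Un_eq:
  fixes f g :: "'a \<Rightarrow> 'b :: comm_semiring_1"
  assumes D: "finite D"
  shows "(\<Sum>(A, B) | A \<union> B = D. prod f A * prod g B) = (\<Prod>x\<in>D. f x + g x + f x * g x)"
proof -
  have inner: "(\<Sum>B | A \<union> B = D. prod g B) = prod g (D - A) * (\<Prod>x\<in>A. 1 + g x)" if "A \<subseteq> D" for A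
  proof -
    have "finite A" using that D by (rule finite_subset)
    have bij: "bij_betw (\<lambda>X. (D - A) \<union> X) (Pow A) {B. A \<union> B = D}"
      by (rule bij_betwI[where g = "\<lambda>B. B \<inter> A"]) (use that in auto)
    have "(\<Sum>B | A \<union> B = D. prod g B) = (\<Sum>X\<in>Pow A. prod g ((D - A) \<union> X))"
      by (rule sum.reindex_bij_betw[OF bij, symmetric])
    also have "\<dots> = (\<Sum>X\<in>Pow A. prod g (D - A) * prod g X)"
      using D \<open>finite A\<close> finite_subset by (intro sum.cong refl prod.union_disjoint) auto
    also have "\<dots> = prod g (D - A) * (\<Prod>x\<in>A. 1 + g x)"
      by (simp add: sum_prod_Pow[OF \<open>finite A\<close>] flip: sum_distrib_left)
    finally show ?thesis .
  qed
  have "{(A, B). A \<union> B = D} = Sigma (Pow D) (\<lambda>A. {B. A \<union> B = D})" by auto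
  moreover have "finite {B. A \<union> B = D}" for A
    by (rule finite_subset[of _ "Pow D"]) (use D in auto)
  ultimately have "(\<Sum>(A, B) | A \<union> B = D. prod f A * prod g B)
      = (\<Sum>A\<in>Pow D. \<Sum>B | A \<union> B = D. prod f A * prod g B)"
    using D by (simp add: sum.Sigma)
  also have "\<dots> = (\<Sum>A\<in>Pow D. (\<Prod>x\<in>A. f x * (1 + g x)) * prod g (D - A))"
    by (intro sum.cong refl) (simp add: inner prod.distrib mult_ac flip: sum_distrib_left)
  also have "\<dots> = (\<Prod>x\<in>D. f x * (1 + g x) + g x)"
    by (rule prod_add[OF D, symmetric])
  finally show ?thesis by (simp add: algebra_simps)
qed

text \<open>With \<open>f = g\<close> this raises the dimension of the sieve: \<open>f q \<approx> 1 / q\<close> on both sides gives \<open>2 / q\<close>.\<close>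

lemma truncated_euler_product_mult_le:
  assumes P: "finite P" "0 \<notin> P" and nonneg: "\<And>q. q \<in> P \<Longrightarrow> 0 \<le> f q" "\<And>q. q \<in> P \<Longrightarrow> 0 \<le> g q"
    and "y \<ge> 0"
  shows "truncated_euler_product f P y * truncated_euler_product g P z
    \<le> truncated_euler_product (\<lambda>q. f q + g q + f q * g q) P (y * z)"
proof -
  let ?X = "subsets_prod_le P y \<times> subsets_prod_le P z" and ?T = "subsets_prod_le P (y * z)"
  have Un_mem: "(\<lambda>(A, B). A \<union> B) ` ?X \<subseteq> ?T"
  proof safe
    fix A B assume AB: "A \<in> subsets_prod_le P y" "B \<in> subsets_prod_le P z"
    have "(\<Prod>q\<in>A \<union> B. real q) \<le> (\<Prod>q\<in>A. real q) * (\<Prod>q\<in>B. real q)"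
      using AB P finite_mem_subsets_prod_le[OF P(1)]
      by (intro prod_Un_le) (auto simp: Suc_le_eq intro!: Nat.gr0I dest: subsets_prod_leD(1))
    also have "\<dots> \<le> y * z"
      using AB[THEN subsets_prod_leD(2)] \<open>y \<ge> 0\<close> by (intro mult_mono prod_nonneg) auto
    finally show "A \<union> B \<in> ?T" using AB by (auto simp: subsets_prod_le_def)
  qed
  have "truncated_euler_product f P y * truncated_euler_product g P z = (\<Sum>(A, B)\<in>?X. prod f A * prod g B)"
    by (simp add: truncated_euler_product_def sum_product sum.cartesian_product)
  also have "\<dots> = (\<Sum>D\<in>?T. \<Sum>(A, B)\<in>{x \<in> ?X. (\<lambda>(A, B). A \<union> B) x = D}. prod f A * prod g B)"
    using P(1) by (intro sum.group[symmetric] Un_mem finite_cartesian_product finite_subsets_prod_le)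
  also have "\<dots> \<le> (\<Sum>D\<in>?T. \<Sum>(A, B) | A \<union> B = D. prod f A * prod g B)"
  proof (intro sum_mono sum_mono2)
    fix D assume "D \<in> ?T"
    then have D: "D \<subseteq> P" "finite D" using P(1) by (auto dest: subsets_prod_leD(1) finite_mem_subsets_prod_le)
    show "finite {(A, B). A \<union> B = D}"
      by (rule finite_subset[of _ "Pow D \<times> Pow D"]) (use D(2) in auto)
    fix x assume "x \<in> {(A, B). A \<union> B = D} - {x \<in> ?X. (\<lambda>(A, B). A \<union> B) x = D}"
    then obtain A B where "x = (A, B)" "A \<subseteq> P" "B \<subseteq> P" using D(1) by auto
    then show "0 \<le> (case x of (A, B) \<Rightarrow> prod f A * prod g B)"
      using nonneg by (auto intro!: mult_nonneg_nonneg prod_nonneg)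
  qed auto
  also have "\<dots> = truncated_euler_product (\<lambda>q. f q + g q + f q * g q) P (y * z)"
    unfolding truncated_euler_product_def
    using finite_mem_subsets_prod_le[OF P(1)] by (intro sum.cong refl sum_prod_Un_eq) auto
  finally show ?thesis .
qed

lemma sum_power_from_1_le:
  fixes x :: real
  assumes "0 \<le> x" "x < 1"
  shows "(\<Sum>j=1..J. x ^ j) \<le> x / (1 - x)"
proof -
  have "(\<Sum>j=1..J. x ^ j) \<le> (x - x ^ Suc J) / (1 - x)"
    using assms unfolding sum_gp by simp
  also have "\<dots> \<le> x / (1 - x)" using assms by (intro divide_right_mono) auto
  finally show ?thesis .
qed

lemma multiplicity_less_self:
  fixes p n :: nat
  assumes "prime p" "n > 0"
  shows "multiplicity p n < n"
proof -
  have "multiplicity p n < p ^ multiplicity p n"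
    using prime_gt_1_nat[OF assms(1)] by (intro power_gt_expt) simp
  also have "\<dots> \<le> n" using assms(2) by (intro dvd_imp_le multiplicity_dvd)
  finally show ?thesis .
qed

lemma inj_on_multiplicities:
  "inj_on (\<lambda>n. restrict (\<lambda>q. multiplicity q n) D) {n :: nat. n > 0 \<and> prime_factors n = D}"
proof
  let ?u = "\<lambda>n. restrict (\<lambda>q. multiplicity q n) D"
  fix m n :: nat
  assume mn: "m \<in> {n. n > 0 \<and> prime_factors n = D}" "n \<in> {n. n > 0 \<and> prime_factors n = D}"
    and eq: "?u m = ?u n"
  show "m = n"
  proof (rule multiplicity_eq_nat)
    fix p :: nat assume "prime p"
    show "multiplicity p m = multiplicity p n"
    proof (cases "p \<in> D")
      case True
      then show ?thesis using fun_cong[OF eq, of p] by simp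
    next
      case False
      then have "p \<notin> prime_factors m" "p \<notin> prime_factors n" using mn by simp_all
      then show ?thesis using \<open>prime p\<close> by (simp add: prime_factors_multiplicity)
    qed
  qed (use mn in auto)
qed

lemma sum_inverse_with_prime_factors_le:
  fixes D A :: "nat set"
  assumes A: "finite A" "0 \<notin> A" and D: "finite D" "\<And>q. q \<in> D \<Longrightarrow> prime q"
  shows "(\<Sum>n | n \<in> A \<and> prime_factors n = D. 1 / real n) \<le> (\<Prod>q\<in>D. 1 / (real q - 1))"
proof -
  define J where "J = Max (insert 0 A)"
  let ?S = "{n. n \<in> A \<and> prime_factors n = D}" and ?u = "\<lambda>n. restrict (\<lambda>q. multiplicity q n) D"
  have pos: "n > 0" if "n \<in> A" for n using that A(2) by (auto intro!: Nat.gr0I)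
  have inj: "inj_on ?u ?S"
    by (rule inj_on_subset[OF inj_on_multiplicities]) (auto intro: pos)
  have exponents: "?u ` ?S \<subseteq> PiE D (\<lambda>_. {1..J})"
  proof (intro image_subsetI PiE_I)
    fix n q assume n: "n \<in> ?S" and q: "q \<in> D"
    have "multiplicity q n > 0" using n q by (auto simp: prime_factors_multiplicity)
    moreover have "multiplicity q n < n" using n q D(2) pos by (intro multiplicity_less_self) auto
    moreover have "n \<le> J" unfolding J_def using A(1) n by simp
    ultimately show "?u n q \<in> {1..J}" using q by simp
  qed simp
  have "(\<Sum>n\<in>?S. 1 / real n) = (\<Sum>n\<in>?S. \<Prod>q\<in>D. (1 / real q) ^ ?u n q)"
  proof (intro sum.cong refl)
    fix n assume n: "n \<in> ?S"
    then have "n = (\<Prod>q\<in>D. q ^ multiplicity q n)"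
      using prime_factorization_nat[of n] pos by auto
    then have "real n = real (\<Prod>q\<in>D. q ^ multiplicity q n)" by (rule arg_cong)
    then show "1 / real n = (\<Prod>q\<in>D. (1 / real q) ^ ?u n q)"
      by (simp add: prod_dividef power_divide)
  qed
  also have "\<dots> = (\<Sum>v\<in>?u ` ?S. \<Prod>q\<in>D. (1 / real q) ^ v q)"
    by (subst sum.reindex[OF inj]) simp
  also have "\<dots> \<le> (\<Sum>v\<in>PiE D (\<lambda>_. {1..J}). \<Prod>q\<in>D. (1 / real q) ^ v q)"
    using exponents D(1) by (intro sum_mono2 finite_PiE prod_nonneg) auto
  also have "\<dots> = (\<Prod>q\<in>D. \<Sum>j=1..J. (1 / real q) ^ j)"
    using D(1) by (subst prod_sum_PiE) auto
  also have "\<dots> \<le> (\<Prod>q\<in>D. 1 / (real q - 1))"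
  proof (intro prod_mono conjI sum_nonneg)
    fix q assume "q \<in> D"
    then have "real q > 1" using D(2) prime_gt_1_nat by auto
    then have "(1 / real q) / (1 - 1 / real q) = 1 / (real q - 1)" by (simp add: field_simps)
    then show "(\<Sum>j=1..J. (1 / real q) ^ j) \<le> 1 / (real q - 1)"
      using sum_power_from_1_le[of "1 / real q" J] \<open>real q > 1\<close> by simp
  qed simp
  finally show ?thesis .
qed

lemma prod_prime_factors_le:
  fixes n :: nat
  assumes "n > 0"
  shows "\<Prod>(prime_factors n) \<le> n"
proof -
  have "(\<Prod>q\<in>prime_factors n. q) dvd (\<Prod>q\<in>prime_factors n. q ^ multiplicity q n)"
    by (rule prod_dvd_prod) (auto simp: prime_factors_multiplicity dvd_power)
  then show ?thesis using assms prime_factorization_nat[of n] by (auto intro: dvd_imp_le)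
qed

lemma ln_le_truncated_euler_product:
  fixes z :: real
  assumes z: "z \<ge> 1" and P: "finite P" "\<And>q. q \<in> P \<Longrightarrow> prime q"
    and primes_mem: "\<And>q. prime q \<Longrightarrow> real q \<le> z \<Longrightarrow> q \<in> P"
  shows "ln z \<le> truncated_euler_product (\<lambda>q. 1 / (real q - 1)) P z"
proof -
  let ?Z = "nat \<lfloor>z\<rfloor>"
  have prime_factors_mem: "prime_factors ` {1..?Z} \<subseteq> subsets_prod_le P z"
  proof safe
    fix n assume "n \<in> {1..?Z}"
    then have n: "n > 0" "real n \<le> z" using z by (auto simp: le_nat_iff le_floor_iff)
    have "real (\<Prod>(prime_factors n)) \<le> real n"
      using prod_prime_factors_le[OF n(1)] by (simp only: of_nat_le_iff)
    moreover have "q \<in> P" if "q \<in> prime_factors n" for q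
    proof (rule primes_mem)
      have "q \<le> n" using that n(1) by (auto simp: prime_factors_dvd intro: dvd_imp_le)
      then show "real q \<le> z" using n(2) by simp
    qed (use that in auto)
    ultimately show "prime_factors n \<in> subsets_prod_le P z"
      using n(2) by (auto simp: subsets_prod_le_def)
  qed
  have "ln z \<le> ln (real ?Z + 1)" using z by (intro ln_mono) linarith+
  also have "\<dots> \<le> harm ?Z" by (rule ln_le_harm)
  also have "\<dots> = (\<Sum>n\<in>{1..?Z}. 1 / real n)" by (simp add: harm_def inverse_eq_divide)
  also have "\<dots> = (\<Sum>D\<in>subsets_prod_le P z. \<Sum>n | n \<in> {1..?Z} \<and> prime_factors n = D. 1 / real n)"
    using P(1) by (intro sum.group[symmetric] prime_factors_mem finite_subsets_prod_le) auto
  also have "\<dots> \<le> truncated_euler_product (\<lambda>q. 1 / (real q - 1)) P z"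
    unfolding truncated_euler_product_def
  proof (intro sum_mono sum_inverse_with_prime_factors_le)
    fix D assume D: "D \<in> subsets_prod_le P z"
    show "finite D" by (rule finite_mem_subsets_prod_le[OF P(1) D])
    show "prime q" if "q \<in> D" for q using that subsets_prod_leD(1)[OF D] P(2) by blast
  qed auto
  finally show ?thesis .
qed

section \<open>Selberg's sieve\<close>

lemma selberg_weights_subsets_prod_le:
  assumes P: "finite P" "0 \<notin> P" and "z \<ge> 1" and g: "\<And>q. q \<in> P \<Longrightarrow> 0 < g q \<and> g q < 1"
  shows "selberg_weights (subsets_prod_le P z) g"
proof
  show "finite (subsets_prod_le P z)" using P(1) by (rule finite_subsets_prod_le)
  show "subsets_prod_le P z \<noteq> {}"
    using \<open>z \<ge> 1\<close> by (auto simp: subsets_prod_le_def intro!: exI[of _ "{}"])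
  show "E \<in> subsets_prod_le P z" if "D \<in> subsets_prod_le P z" "E \<subseteq> D" for D E
    by (rule subset_mem_subsets_prod_le[OF P that])
  show "0 < g q \<and> g q < 1" if "D \<in> subsets_prod_le P z" "q \<in> D" for D q
    using g[of q] subsets_prod_leD(1)[OF that(1)] that(2) by auto
qed

lemma prod_Un_divide_le:
  fixes f g :: "'a \<Rightarrow> real"
  assumes "finite A" "finite B" "\<And>x. x \<in> A \<union> B \<Longrightarrow> 1 \<le> f x" "\<And>x. x \<in> A \<union> B \<Longrightarrow> 0 < g x"
  shows "prod f (A \<union> B) / (prod g A * prod g B) \<le> (\<Prod>x\<in>A. f x / g x) * (\<Prod>x\<in>B. f x / g x)"
proof -
  have "prod g A > 0" "prod g B > 0" using assms(4) by (auto intro!: prod_pos)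
  then have "prod f (A \<union> B) / (prod g A * prod g B) \<le> prod f A * prod f B / (prod g A * prod g B)"
    using assms(1-3) by (intro divide_right_mono prod_Un_le) auto
  then show ?thesis by (simp add: prod_dividef)
qed

lemma sum_sieve_remainder_le:
  fixes \<omega> :: "nat \<Rightarrow> real" and z :: real
  assumes P: "finite P" "\<And>q. q \<in> P \<Longrightarrow> prime q" and \<omega>: "\<And>q. q \<in> P \<Longrightarrow> 1 \<le> \<omega> q" and z: "z \<ge> 0"
  defines "\<D> \<equiv> subsets_prod_le P z"
  shows "(\<Sum>D\<in>\<D>. \<Sum>E\<in>\<D>. prod \<omega> (D \<union> E) / ((\<Prod>q\<in>D. \<omega> q / real q) * (\<Prod>q\<in>E. \<omega> q / real q))) \<le> z ^ 4"
proof -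
  have "(\<Sum>D\<in>\<D>. \<Sum>E\<in>\<D>. prod \<omega> (D \<union> E) / ((\<Prod>q\<in>D. \<omega> q / real q) * (\<Prod>q\<in>E. \<omega> q / real q)))
      \<le> (\<Sum>D\<in>\<D>. \<Sum>E\<in>\<D>. z\<^sup>2)"
  proof (intro sum_mono)
    fix D E assume D: "D \<in> \<D>" and E: "E \<in> \<D>"
    have finite: "finite D" "finite E"
      using D E finite_mem_subsets_prod_le[OF P(1)] unfolding \<D>_def by blast+
    have "q \<in> P" if "q \<in> D \<union> E" for q
      using that D E subsets_prod_leD(1) unfolding \<D>_def by blast
    then have pos: "1 \<le> \<omega> q" "0 < real q" if "q \<in> D \<union> E" for q
      using that \<omega> prime_gt_0_nat[OF P(2)] by auto
    have "prod \<omega> (D \<union> E) / ((\<Prod>q\<in>D. \<omega> q / real q) * (\<Prod>q\<in>E. \<omega> q / real q))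
        \<le> (\<Prod>q\<in>D. \<omega> q / (\<omega> q / real q)) * (\<Prod>q\<in>E. \<omega> q / (\<omega> q / real q))"
      using finite pos by (intro prod_Un_divide_le) force+
    also have "\<dots> = (\<Prod>q\<in>D. real q) * (\<Prod>q\<in>E. real q)"
      using pos by (intro arg_cong2[where f = "(*)"] prod.cong) force+
    also have "\<dots> \<le> z\<^sup>2"
      unfolding power2_eq_square using D E z subsets_prod_leD(2) unfolding \<D>_def
      by (intro mult_mono prod_nonneg) auto
    finally show "prod \<omega> (D \<union> E) / ((\<Prod>q\<in>D. \<omega> q / real q) * (\<Prod>q\<in>E. \<omega> q / real q)) \<le> z\<^sup>2" .
  qed
  also have "\<dots> = (real (card \<D>))\<^sup>2 * z\<^sup>2" by (simp add: power2_eq_square)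
  also have "\<dots> \<le> z\<^sup>2 * z\<^sup>2"
    using card_subsets_prod_le[OF P z] by (intro mult_right_mono power_mono) (auto simp: \<D>_def)
  finally show ?thesis by (simp flip: power_add)
qed

text \<open>The crude remainder \<open>z ^ 4\<close> suffices below, where \<open>z\<close> is a small power of \<open>N\<close>.\<close>

theorem selberg_sieve:
  fixes P :: "nat set" and \<Omega> :: "nat \<Rightarrow> nat set" and z :: real
  assumes P: "finite P" "\<And>q. q \<in> P \<Longrightarrow> prime q"
    and \<Omega>: "\<And>q. q \<in> P \<Longrightarrow> \<Omega> q \<subseteq> {..<q}"
    and \<omega>: "\<And>q. q \<in> P \<Longrightarrow> 0 < \<omega> q \<and> \<omega> q < q" "\<And>q. q \<in> P \<Longrightarrow> \<omega> q = card (\<Omega> q)"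
    and z: "z \<ge> 1"
  shows "real (card {n. n < N \<and> (\<forall>q\<in>P. n mod q \<notin> \<Omega> q)})
    \<le> real N / truncated_euler_product (\<lambda>q. \<omega> q / (real q - \<omega> q)) P z + z ^ 4"
proof -
  let ?D = "subsets_prod_le P z"
  define B where "B n = {q \<in> P. n mod q \<in> \<Omega> q}" for n
  define W where "W D = (\<Prod>q\<in>D. real (\<omega> q))" for D
  have "0 \<notin> P" using P(2) not_prime_0 by blast
  have mem: "finite D" "D \<subseteq> P" "0 \<notin> D" if "D \<in> ?D" for D
    using finite_mem_subsets_prod_le[OF P(1) that] subsets_prod_leD(1)[OF that] \<open>0 \<notin> P\<close> by auto
  interpret selberg_weights ?D "\<lambda>q. real (\<omega> q) / real q"
    using P(1) \<open>0 \<notin> P\<close> z \<omega>(1)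
    by (intro selberg_weights_subsets_prod_le) (fastforce simp: divide_less_eq)+
  have total: "dual_total = truncated_euler_product (\<lambda>q. \<omega> q / (real q - \<omega> q)) P z"
    unfolding dual_total_def dual_density_def truncated_euler_product_def
  proof (intro sum.cong prod.cong refl)
    fix D q assume "D \<in> ?D" "q \<in> D"
    then have "0 < \<omega> q" "\<omega> q < q" using mem \<omega>(1) by blast+
    then show "real (\<omega> q) / real q / (1 - real (\<omega> q) / real q) = real (\<omega> q) / (real q - real (\<omega> q))"
      by (simp add: field_simps)
  qed
  have "real (card {n \<in> {..<N}. B n = {}}) \<le> real N / dual_total
      + (\<Sum>D\<in>?D. \<Sum>E\<in>?D. W (D \<union> E) / (joint_density D * joint_density E))"
  proof (rule card_sifted_le)
    fix D E assume "D \<in> ?D" "E \<in> ?D"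
    then have DE: "D \<union> E \<subseteq> P" "finite (D \<union> E)" "0 \<notin> D \<union> E" using mem by auto
    then have "{n \<in> {..<N}. D \<union> E \<subseteq> B n} = {n. n < N \<and> (\<forall>q\<in>D \<union> E. n mod q \<in> \<Omega> q)}"
      by (auto simp: B_def)
    moreover have "\<bar>real (card {n. n < N \<and> (\<forall>q\<in>D \<union> E. n mod q \<in> \<Omega> q)})
        - real N * (\<Prod>q\<in>D \<union> E. real (card (\<Omega> q)) / real q)\<bar> \<le> (\<Prod>q\<in>D \<union> E. real (card (\<Omega> q)))"
      using DE P(2) \<Omega> by (intro card_residue_vectors_less primes_coprime) blast+
    moreover have "card (\<Omega> q) = \<omega> q" if "q \<in> D \<union> E" for q using \<omega>(2) DE(1) that by auto
    ultimately show "\<bar>real (card {n \<in> {..<N}. D \<union> E \<subseteq> B n}) - real N * joint_density (D \<union> E)\<bar> \<le> W (D \<union> E)"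
      unfolding joint_density_def W_def by simp
  qed simp
  also have "(\<Sum>D\<in>?D. \<Sum>E\<in>?D. W (D \<union> E) / (joint_density D * joint_density E)) \<le> z ^ 4"
    unfolding W_def joint_density_def
    by (rule sum_sieve_remainder_le[OF P]) (use \<omega>(1) z in \<open>auto simp: Suc_le_eq\<close>)
  also have "{n \<in> {..<N}. B n = {}} = {n. n < N \<and> (\<forall>q\<in>P. n mod q \<notin> \<Omega> q)}" by (auto simp: B_def)
  finally show ?thesis unfolding total by simp
qed

lemma card_not_dvd_values_le:
  fixes P :: "nat set" and f :: "nat \<Rightarrow> nat" and z :: real
  assumes P: "finite P" "\<And>q. q \<in> P \<Longrightarrow> prime q"
    and f: "\<And>m n q. [m = n] (mod q) \<Longrightarrow> [f m = f n] (mod q)"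
    and "\<And>q. q \<in> P \<Longrightarrow> card {r. r < q \<and> q dvd f r} = \<omega> q" "\<And>q. q \<in> P \<Longrightarrow> 0 < \<omega> q \<and> \<omega> q < q"
    and z: "z \<ge> 1"
  shows "real (card {n. n < N \<and> (\<forall>q\<in>P. \<not> q dvd f n)})
    \<le> real N / truncated_euler_product (\<lambda>q. \<omega> q / (real q - \<omega> q)) P z + z ^ 4"
proof -
  have "n mod q \<in> {r. r < q \<and> q dvd f r} \<longleftrightarrow> q dvd f n" if "q \<in> P" for n q
  proof -
    have "q dvd f (n mod q) \<longleftrightarrow> q dvd f n" by (intro cong_dvd_iff f) simp
    then show ?thesis using P(2)[OF that] prime_gt_0_nat by simp
  qed
  then have "{n. n < N \<and> (\<forall>q\<in>P. \<not> q dvd f n)} = {n. n < N \<and> (\<forall>q\<in>P. n mod q \<notin> {r. r < q \<and> q dvd f r})}"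
    by auto
  moreover have "real (card {n. n < N \<and> (\<forall>q\<in>P. n mod q \<notin> {r. r < q \<and> q dvd f r})})
    \<le> real N / truncated_euler_product (\<lambda>q. \<omega> q / (real q - \<omega> q)) P z + z ^ 4"
    by (rule selberg_sieve) (use assms in auto)
  ultimately show ?thesis by simp
qed

section \<open>The ratio of an integer to its totient\<close>

definition totient_ratio :: "nat \<Rightarrow> real" where
  "totient_ratio n = real n / real (totient n)"

lemma totient_ratio_ge_1:
  assumes "n > 0"
  shows "totient_ratio n \<ge> 1"
  using assms totient_le[of n] by (simp add: totient_ratio_def)

lemma totient_ratio_nonneg: "totient_ratio n \<ge> 0"
  by (simp add: totient_ratio_def)

lemma totient_ratio_eq_prod:
  assumes "n > 0"
  shows "totient_ratio n = (\<Prod>q\<in>prime_factors n. 1 + 1 / (real q - 1))"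
proof -
  have "totient_ratio n = (\<Prod>q\<in>prime_factors n. 1 / (1 - 1 / real q))"
    using assms by (simp add: totient_ratio_def totient_formula2 prod_dividef)
  also have "\<dots> = (\<Prod>q\<in>prime_factors n. 1 + 1 / (real q - 1))"
  proof (intro prod.cong refl)
    fix q assume "q \<in> prime_factors n"
    then have "prime q" by (rule in_prime_factors_imp_prime)
    from prime_gt_1_nat[OF this] show "1 / (1 - 1 / real q) = 1 + 1 / (real q - 1)" by (simp add: field_simps)
  qed
  finally show ?thesis .
qed

lemma totient_ratio_mult_le: "totient_ratio (a * b) \<le> totient_ratio a * totient_ratio b"
proof (cases "a = 0 \<or> b = 0")
  case False
  let ?g = "gcd a b"
  have "real (totient (a * b)) * real (totient ?g) = real (totient a) * real (totient b) * real ?g"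
    using totient_gcd[of a b] by (simp flip: of_nat_mult)
  then have "totient_ratio a * totient_ratio b = totient_ratio (a * b) * totient_ratio ?g"
    using False by (simp add: totient_ratio_def field_simps)
  moreover have "totient_ratio (a * b) * 1 \<le> totient_ratio (a * b) * totient_ratio ?g"
    using False by (intro mult_left_mono totient_ratio_ge_1 totient_ratio_nonneg) simp
  ultimately show ?thesis by simp
qed (auto simp: totient_ratio_def)

lemma totient_ratio_prime:
  assumes "prime q"
  shows "totient_ratio q = 1 + 1 / (real q - 1)"
  using assms totient_ratio_eq_prod[of q] by (simp add: prime_gt_0_nat prime_prime_factors)

lemma totient_ratio_power_2_le: "totient_ratio (2 ^ l) \<le> 2"
proof (cases l)
  case (Suc k)
  then have "totient (2 ^ l) = 2 ^ k" using totient_power_Suc[of 2 k] by simp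
  then show ?thesis using Suc by (simp add: totient_ratio_def)
qed (simp add: totient_ratio_def)

lemma ln_div_totient_ratio_le_truncated_euler_product:
  fixes z :: real and M :: nat
  assumes M: "M > 0" and z: "z \<ge> 1" and P: "finite P" "\<And>q. q \<in> P \<Longrightarrow> prime q"
    and "\<And>q. prime q \<Longrightarrow> real q \<le> z \<Longrightarrow> q \<in> P"
  shows "ln z / totient_ratio M \<le> truncated_euler_product (\<lambda>q. 1 / (real q - 1)) (P - {q. q dvd M}) z"
proof -
  let ?h = "\<lambda>q. 1 / (real q - 1)" and ?R = "{q. q dvd M}"
  have h: "0 \<le> ?h q" if "q \<in> P" for q using prime_gt_1_nat[OF P(2)[OF that]] by simp
  have "ln z \<le> truncated_euler_product ?h P z"
    using assms by (intro ln_le_truncated_euler_product)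
  also have "\<dots> \<le> (\<Prod>q\<in>P \<inter> ?R. 1 + ?h q) * truncated_euler_product ?h (P - ?R) z"
    using P not_prime_0 h by (intro truncated_euler_product_le_Diff) blast+
  also have "\<dots> \<le> totient_ratio M * truncated_euler_product ?h (P - ?R) z"
  proof (rule mult_right_mono)
    have "1 \<le> 1 + ?h q" if "q \<in> prime_factors M" for q
    proof -
      have "prime q" using that by (rule in_prime_factors_imp_prime)
      from prime_gt_1_nat[OF this] show ?thesis by simp
    qed
    then show "(\<Prod>q\<in>P \<inter> ?R. 1 + ?h q) \<le> totient_ratio M"
      unfolding totient_ratio_eq_prod[OF M] using M P(2)
      by (intro prod_subset_le) (auto simp: in_prime_factors_iff)
    show "0 \<le> truncated_euler_product ?h (P - ?R) z"
      using h by (intro truncated_euler_product_nonneg) auto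
  qed
  finally show ?thesis using totient_ratio_ge_1[OF M] by (simp add: divide_le_eq mult.commute)
qed

section \<open>Primes in residue classes and prime pairs\<close>

definition primes_le :: "real \<Rightarrow> nat set" where
  "primes_le x = {p. prime p \<and> real p \<le> x}"

lemma finite_primes_le: "finite (primes_le x)"
  by (rule finite_subset[of _ "{..nat \<lfloor>x\<rfloor>}"]) (auto simp: primes_le_def le_nat_floor)

lemma primes_leD: "p \<in> primes_le x \<Longrightarrow> prime p"
  by (simp add: primes_le_def)

lemma not_dvd_prime_greater:
  assumes "q \<in> primes_le z" "prime p" "z < real p"
  shows "\<not> q dvd p"
  using assms primes_dvd_imp_eq[of q p] by (auto simp: primes_le_def)

lemma card_le_card_greater_add:
  fixes v :: "'a \<Rightarrow> nat" and z :: real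
  assumes A: "finite A" "inj_on v A" "0 \<notin> v ` A" and "z \<ge> 0"
  shows "real (card A) \<le> real (card {x \<in> A. z < real (v x)}) + z"
proof -
  have "A = {x \<in> A. z < real (v x)} \<union> {x \<in> A. real (v x) \<le> z}" by auto
  then have "card A \<le> card {x \<in> A. z < real (v x)} + card {x \<in> A. real (v x) \<le> z}"
    by (metis card_Un_le)
  moreover have "card {x \<in> A. real (v x) \<le> z} \<le> card {1..nat \<lfloor>z\<rfloor>}"
  proof (rule card_inj_on_le)
    show "inj_on v {x \<in> A. real (v x) \<le> z}" using A(2) by (rule inj_on_subset) auto
    show "v ` {x \<in> A. real (v x) \<le> z} \<subseteq> {1..nat \<lfloor>z\<rfloor>}"
      using A(3) by (auto simp: le_nat_floor Suc_le_eq intro!: Nat.gr0I)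
  qed simp
  moreover have "real (card {1..nat \<lfloor>z\<rfloor>}) \<le> z" using \<open>z \<ge> 0\<close> by simp
  ultimately show ?thesis by linarith
qed

lemma sqrt_le_div_ln:
  fixes x :: real
  assumes "x > 1"
  shows "sqrt x \<le> 2 * x / ln x"
proof -
  have "sqrt x * ln x \<le> sqrt x * (2 * sqrt x)"
    using ln_powr_bound[of x "1/2"] assms by (intro mult_left_mono) (simp_all add: powr_half_sqrt)
  also have "\<dots> = 2 * x" using assms by simp
  finally show ?thesis using assms by (simp add: field_simps)
qed

lemma sqrt_le_div_ln_power2:
  fixes x :: real
  assumes "x > 1"
  shows "sqrt x \<le> 16 * x / (ln x)\<^sup>2"
proof -
  have "(ln x)\<^sup>2 \<le> (4 * x powr (1/4))\<^sup>2"
    using ln_powr_bound[of x "1/4"] assms by (intro power_mono) auto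
  also have "\<dots> = 16 * sqrt x"
    using assms by (simp add: power_mult_distrib powr_power powr_half_sqrt)
  finally have "sqrt x * (ln x)\<^sup>2 \<le> sqrt x * (16 * sqrt x)"
    using assms by (intro mult_left_mono) auto
  also have "\<dots> = 16 * x" using assms by simp
  finally show ?thesis using assms by (simp add: field_simps)
qed

lemma powr_eighth_level:
  fixes x :: real
  assumes "x > 1"
  defines "z \<equiv> x powr (1/8)"
  shows "z > 1" "ln z = ln x / 8" "z ^ 4 + z \<le> 2 * sqrt x"
proof -
  have "z ^ 4 = sqrt x" unfolding z_def using assms by (simp add: powr_power powr_half_sqrt)
  moreover have "z \<le> x powr (1/2)" unfolding z_def using assms by (intro powr_mono) auto
  ultimately show "z ^ 4 + z \<le> 2 * sqrt x" using assms by (simp add: powr_half_sqrt)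
qed (use assms in \<open>auto simp: ln_powr intro: gr_one_powr\<close>)

lemma card_linear_root:
  fixes M b q :: nat
  assumes "coprime M q" "q > 0"
  shows "card {r. r < q \<and> q dvd b + M * r} = 1"
proof -
  have "q dvd b + M * r \<longleftrightarrow> [M * r = b * (q - 1)] (mod q)" for r
  proof -
    have "b + b * (q - 1) = b * q" using assms(2) by (cases q) auto
    then have "[b + b * (q - 1) = 0] (mod q)" by (simp add: cong_0_iff)
    then have "[b + M * r = 0] (mod q) \<longleftrightarrow> [b + M * r = b + b * (q - 1)] (mod q)"
      using cong_sym cong_trans by blast
    then show ?thesis by (simp add: cong_0_iff cong_add_lcancel_nat)
  qed
  moreover have "\<exists>!r. r < q \<and> [M * r = b * (q - 1)] (mod q)"
    using assms by (intro cong_solve_unique) auto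
  ultimately show ?thesis
    by (simp only: One_nat_def card_1_singleton_iff) (auto simp: set_eq_iff)
qed

lemma card_linear_not_dvd_le:
  fixes M b N :: nat and z :: real
  assumes M: "M > 0" and z: "z > 1"
  shows "real (card {n. n < N \<and> (\<forall>q\<in>primes_le z - {q. q dvd M}. \<not> q dvd b + M * n)})
    \<le> real N * totient_ratio M / ln z + z ^ 4"
proof -
  let ?Q = "primes_le z - {q. q dvd M}"
  let ?L = "truncated_euler_product (\<lambda>q. 1 / (real q - 1)) ?Q z"
  have "real (card {n. n < N \<and> (\<forall>q\<in>?Q. \<not> q dvd b + M * n)})
      \<le> real N / truncated_euler_product (\<lambda>q. real 1 / (real q - real 1)) ?Q z + z ^ 4"
  proof (rule card_not_dvd_values_le)
    fix q assume "q \<in> ?Q"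
    then have q: "prime q" "\<not> q dvd M" by (auto dest: primes_leD)
    then have "coprime M q" by (metis coprime_commute prime_imp_coprime)
    then show "card {r. r < q \<and> q dvd b + M * r} = 1"
      using prime_gt_0_nat[OF q(1)] by (rule card_linear_root)
    show "0 < (1 :: nat) \<and> 1 < q" using prime_gt_1_nat[OF q(1)] by simp
  next
    show "[b + M * m = b + M * n] (mod q)" if "[m = n] (mod q)" for m n q
      using that by (intro cong_add cong_mult cong_refl)
  qed (use z in \<open>auto intro: finite_primes_le primes_leD\<close>)
  also have "real N / truncated_euler_product (\<lambda>q. real 1 / (real q - real 1)) ?Q z = real N / ?L" by simp
  also have "\<dots> \<le> real N / (ln z / totient_ratio M)"
  proof (rule divide_left_mono)
    show lower: "ln z / totient_ratio M \<le> ?L"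
      using M z finite_primes_le
      by (intro ln_div_totient_ratio_le_truncated_euler_product) (auto simp: primes_le_def)
    have "ln z / totient_ratio M > 0" using z totient_ratio_ge_1[OF M] by simp
    then show "0 < ?L * (ln z / totient_ratio M)" using lower by (intro mult_pos_pos) linarith+
  qed simp
  finally show ?thesis by simp
qed

lemma card_prime_linear_le:
  fixes M b N :: nat
  assumes M: "M > 0" and N: "N \<ge> 2"
  shows "real (card {n. n < N \<and> prime (b + M * n)}) \<le> 12 * totient_ratio M * (real N / ln N)"
proof -
  define z where "z = real N powr (1/8)"
  have z: "z > 1" "ln z = ln N / 8" "z ^ 4 + z \<le> 2 * sqrt N"
    using powr_eighth_level[of "real N"] N by (auto simp: z_def)
  let ?A = "{n. n < N \<and> prime (b + M * n)}"
  let ?S = "{n. n < N \<and> (\<forall>q\<in>primes_le z - {q. q dvd M}. \<not> q dvd b + M * n)}"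
  have "real (card ?A) \<le> real (card {n \<in> ?A. z < real (b + M * n)}) + z"
    using M z(1) by (intro card_le_card_greater_add) (auto simp: inj_on_def dest: prime_gt_0_nat)
  also have "{n \<in> ?A. z < real (b + M * n)} \<subseteq> ?S"
    using not_dvd_prime_greater by auto
  then have "real (card {n \<in> ?A. z < real (b + M * n)}) \<le> real (card ?S)"
    by (intro of_nat_mono card_mono) auto
  also have "\<dots> \<le> real N * totient_ratio M / ln z + z ^ 4"
    using M z(1) by (rule card_linear_not_dvd_le)
  finally have "real (card ?A) \<le> real N * totient_ratio M / ln z + 2 * sqrt N"
    using z(3) by simp
  also have "2 * sqrt N \<le> 1 * (4 * (real N / ln N))"
    using sqrt_le_div_ln[of "real N"] N by simp
  also have "\<dots> \<le> totient_ratio M * (4 * (real N / ln N))"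
    using totient_ratio_ge_1[OF M] N by (intro mult_right_mono) auto
  finally show ?thesis by (simp add: z(2) mult_ac)
qed

lemma card_primes_cong_le:
  fixes M b x :: nat
  assumes M: "M > 0" and x: "x \<ge> 2" "x \<ge> M ^ 2"
  shows "real (card {p. prime p \<and> p \<le> x \<and> [p = b] (mod M)}) \<le> 48 * totient_ratio M * real x / (real M * ln x)"
proof -
  define N where "N = x div M + 1"
  have xM: "x \<ge> M" using x(2) M by (metis le_square order_trans power2_eq_square)
  have N: "N \<ge> 2" using xM M unfolding N_def by (simp add: div_greater_zero_iff Suc_le_eq)
  let ?A = "{p. prime p \<and> p \<le> x \<and> [p = b] (mod M)}" and ?B = "{n. n < N \<and> prime (b mod M + M * n)}"
  have "?A \<subseteq> (\<lambda>n. b mod M + M * n) ` ?B"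
  proof
    fix p assume "p \<in> ?A"
    then have "p = b mod M + M * (p div M)" "prime p" "p div M < N"
      by (auto simp: Cong.cong_def N_def less_Suc_eq_le div_le_mono) (metis mod_mult_div_eq)
    then show "p \<in> (\<lambda>n. b mod M + M * n) ` ?B" by auto
  qed
  then have "card ?A \<le> card ?B" by (rule surj_card_le[rotated]) auto
  then have "real (card ?A) \<le> real (card ?B)" by simp
  also have "\<dots> \<le> 12 * totient_ratio M * (real N / ln N)"
    using M N by (rule card_prime_linear_le)
  also have "\<dots> \<le> 12 * totient_ratio M * (2 * real x / real M / (ln x / 2))"
  proof (intro mult_left_mono frac_le)
    have "real (x div M) \<le> real x / real M" by (rule of_nat_div_le_of_nat)
    moreover have "real x / real M \<ge> 1" using xM M by simp
    ultimately show "real N \<le> 2 * real x / real M" by (simp add: N_def)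
    have "real M \<le> sqrt x" using x(2) by (intro real_le_rsqrt) (metis of_nat_le_iff of_nat_power)
    moreover have "x \<le> M * N" using M by (simp add: N_def dividend_less_times_div less_imp_le)
    then have "real x \<le> real M * real N" by (simp only: of_nat_le_iff flip: of_nat_mult)
    ultimately have "sqrt x * sqrt x \<le> sqrt x * real N"
      using mult_right_mono[of "real M" "sqrt x" "real N"] by simp
    then have "sqrt x \<le> real N" using x(1) by (simp only: mult_le_cancel_left_pos real_sqrt_gt_0_iff)
    then have "ln (sqrt x) \<le> ln N" using x(1) by (intro ln_mono) auto
    then show "ln x / 2 \<le> ln N" using x(1) by (simp add: ln_sqrt)
  qed (use x totient_ratio_nonneg[of M] in auto)
  also have "\<dots> = 48 * totient_ratio M * real x / (real M * ln x)" by simp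
  finally show ?thesis .
qed

lemma card_pair_roots:
  fixes H q :: nat
  assumes "prime q"
  shows "card {r. r < q \<and> q dvd r * (r + H)} = (if q dvd H then 1 else 2)"
proof -
  have "q > 0" using assms by (rule prime_gt_0_nat)
  have "card {r. r < q \<and> q dvd H + 1 * r} = 1" using \<open>q > 0\<close> by (intro card_linear_root) auto
  then obtain s where s: "{r. r < q \<and> q dvd r + H} = {s}"
    by (auto simp: card_1_singleton_iff add.commute)
  have "{r. r < q \<and> q dvd r * (r + H)} = {r. r < q \<and> q dvd r} \<union> {r. r < q \<and> q dvd r + H}"
    using assms by (auto simp: prime_dvd_mult_iff)
  also have "\<dots> = {0, s}"
    unfolding s using \<open>q > 0\<close> by (auto dest: dvd_imp_le)
  finally have roots: "{r. r < q \<and> q dvd r * (r + H)} = {0, s}" .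
  have "s = 0 \<longleftrightarrow> 0 \<in> {r. r < q \<and> q dvd r + H}" unfolding s by auto
  then have "s = 0 \<longleftrightarrow> q dvd H" using \<open>q > 0\<close> by simp
  then show ?thesis unfolding roots by auto
qed

lemma two_inverse_plus_square_le:
  fixes x :: real
  assumes "x > 2"
  shows "1 / (x - 1) + 1 / (x - 1) + 1 / (x - 1) * (1 / (x - 1)) \<le> 2 / (x - 2)"
proof -
  have "1 / s + 1 / s + 1 / s * (1 / s) \<le> 2 / (s - 1)" if "s > 1" for s :: real
    using that by (simp add: field_simps)
  from this[of "x - 1"] show ?thesis using assms by simp
qed

lemma ln_power2_le_truncated_euler_product_pairs:
  fixes y :: real and H :: nat
  assumes H: "H > 0" "even H" and y: "y \<ge> 1"
  defines "\<omega> \<equiv> \<lambda>q. if q dvd H then 1 else 2 :: nat"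
  shows "(ln y)\<^sup>2 / totient_ratio H
    \<le> truncated_euler_product (\<lambda>q. \<omega> q / (real q - \<omega> q)) (primes_le (y * y)) (y * y)"
proof -
  let ?P = "primes_le (y * y)" and ?R = "{q. q dvd H}"
  define f where "f q = 1 / (real q - 1)" for q :: nat
  define g where "g q = (if q \<in> ?R then 0 else f q)" for q
  have f: "0 \<le> f q" if "q \<in> ?P" for q using prime_gt_1_nat[OF primes_leD[OF that]] by (simp add: f_def)
  have "0 \<notin> ?P" by (simp add: primes_le_def)
  have "1 * y \<le> y * y" using y by (intro mult_right_mono) auto
  then have primes: "q \<in> ?P" if "prime q" "real q \<le> y" for q using that by (auto simp: primes_le_def)
  have ln_le: "ln y \<le> truncated_euler_product f ?P y"
    unfolding f_def using y finite_primes_le primes_leD primes by (intro ln_le_truncated_euler_product)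
  have "ln y / totient_ratio H \<le> truncated_euler_product f (?P - ?R) y"
    unfolding f_def using H(1) y finite_primes_le primes_leD primes
    by (intro ln_div_totient_ratio_le_truncated_euler_product)
  also have "\<dots> = truncated_euler_product g ?P y"
    unfolding g_def by (rule truncated_euler_product_Diff[OF finite_primes_le])
  finally have "ln y * (ln y / totient_ratio H)
      \<le> truncated_euler_product f ?P y * truncated_euler_product g ?P y"
    using ln_le y f by (intro mult_mono truncated_euler_product_nonneg)
      (auto intro: divide_nonneg_nonneg totient_ratio_nonneg)
  also have "\<dots> \<le> truncated_euler_product (\<lambda>q. f q + g q + f q * g q) ?P (y * y)"
    using \<open>0 \<notin> ?P\<close> y f
    by (intro truncated_euler_product_mult_le finite_primes_le) (auto simp: g_def)
  also have "\<dots> \<le> truncated_euler_product (\<lambda>q. \<omega> q / (real q - \<omega> q)) ?P (y * y)"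
  proof (intro truncated_euler_product_mono conjI)
    fix q assume q: "q \<in> ?P"
    show "0 \<le> f q + g q + f q * g q" using f[OF q] by (simp add: g_def)
    show "f q + g q + f q * g q \<le> \<omega> q / (real q - \<omega> q)"
    proof (cases "q dvd H")
      case False
      then have "q \<noteq> 2" using H(2) by auto
      then have "real q > 2" using prime_ge_2_nat[OF primes_leD[OF q]] by simp
      then have "f q + f q + f q * f q \<le> 2 / (real q - 2)"
        unfolding f_def by (rule two_inverse_plus_square_le)
      then show ?thesis using False by (simp add: g_def \<omega>_def)
    qed (simp add: f_def g_def \<omega>_def)
  qed
  finally show ?thesis by (simp add: power2_eq_square)
qed

lemma card_pairs_not_dvd_le:
  fixes y :: real and H N :: nat
  assumes H: "H > 0" "even H" and y: "y > 1"
  shows "real (card {n. n < N \<and> (\<forall>q\<in>primes_le (y * y). \<not> q dvd n * (n + H))})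
    \<le> real N * totient_ratio H / (ln y)\<^sup>2 + (y * y) ^ 4"
proof -
  let ?P = "primes_le (y * y)" and ?\<omega> = "\<lambda>q. if q dvd H then 1 else 2 :: nat"
  let ?L = "truncated_euler_product (\<lambda>q. ?\<omega> q / (real q - ?\<omega> q)) ?P (y * y)"
  have "y * y \<ge> 1 * 1" using y by (intro mult_mono) auto
  have "real (card {n. n < N \<and> (\<forall>q\<in>?P. \<not> q dvd n * (n + H))}) \<le> real N / ?L + (y * y) ^ 4"
  proof (rule card_not_dvd_values_le)
    fix q assume q: "q \<in> ?P"
    show "card {r. r < q \<and> q dvd r * (r + H)} = ?\<omega> q" by (rule card_pair_roots[OF primes_leD[OF q]])
    show "0 < ?\<omega> q \<and> ?\<omega> q < q"
      using prime_ge_2_nat[OF primes_leD[OF q]] H(2) by (cases "q = 2") auto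
  next
    show "[m * (m + H) = n * (n + H)] (mod q)" if "[m = n] (mod q)" for m n q
      using that by (intro cong_add cong_mult cong_refl)
  qed (use \<open>y * y \<ge> 1 * 1\<close> in \<open>auto intro: finite_primes_le primes_leD\<close>)
  also have "real N / ?L \<le> real N / ((ln y)\<^sup>2 / totient_ratio H)"
  proof (rule divide_left_mono)
    show lower: "(ln y)\<^sup>2 / totient_ratio H \<le> ?L"
      using H y by (intro ln_power2_le_truncated_euler_product_pairs) auto
    have "(ln y)\<^sup>2 / totient_ratio H > 0" using y totient_ratio_ge_1[OF H(1)] by simp
    then show "0 < ?L * ((ln y)\<^sup>2 / totient_ratio H)" using lower by (intro mult_pos_pos) linarith+
  qed simp
  finally show ?thesis by simp
qed

lemma card_prime_pairs_le:
  fixes H N :: nat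
  assumes H: "H > 0" "even H" and N: "N \<ge> 2"
  shows "real (card {p. p < N \<and> prime p \<and> prime (p + H)}) \<le> 288 * totient_ratio H * (real N / (ln N)\<^sup>2)"
proof -
  define y where "y = real N powr (1/16)"
  define z where "z = real N powr (1/8)"
  have y: "y > 1" "ln y = ln N / 16" "y * y = z"
    using N by (auto simp: y_def z_def ln_powr gr_one_powr simp flip: powr_add)
  have z: "z > 1" "z ^ 4 + z \<le> 2 * sqrt N"
    using powr_eighth_level[of "real N"] N by (auto simp: z_def)
  let ?A = "{p. p < N \<and> prime p \<and> prime (p + H)}"
  let ?S = "{n. n < N \<and> (\<forall>q\<in>primes_le z. \<not> q dvd n * (n + H))}"
  have "real (card ?A) \<le> real (card {p \<in> ?A. z < real p}) + z"
    using z(1) by (intro card_le_card_greater_add[where v = "\<lambda>p. p"]) (auto simp: inj_on_def)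
  also have "{p \<in> ?A. z < real p} \<subseteq> ?S"
  proof (intro subsetI CollectI conjI ballI)
    fix p q assume p: "p \<in> {p \<in> ?A. z < real p}" and q: "q \<in> primes_le z"
    have "\<not> q dvd p" "\<not> q dvd p + H"
      using p not_dvd_prime_greater[OF q, of p] not_dvd_prime_greater[OF q, of "p + H"] by auto
    then show "\<not> q dvd p * (p + H)" using primes_leD[OF q] by (simp add: prime_dvd_mult_iff)
  qed auto
  then have "real (card {p \<in> ?A. z < real p}) \<le> real (card ?S)"
    by (intro of_nat_mono card_mono) auto
  also have "\<dots> \<le> real N * totient_ratio H / (ln y)\<^sup>2 + z ^ 4"
    using card_pairs_not_dvd_le[OF H y(1), of N] by (simp only: y(3))
  finally have "real (card ?A) \<le> real N * totient_ratio H / (ln y)\<^sup>2 + 2 * sqrt N"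
    using z(2) by simp
  also have "2 * sqrt N \<le> 1 * (32 * (real N / (ln N)\<^sup>2))"
    using sqrt_le_div_ln_power2[of "real N"] N by simp
  also have "\<dots> \<le> totient_ratio H * (32 * (real N / (ln N)\<^sup>2))"
    using totient_ratio_ge_1[OF H(1)] by (intro mult_right_mono) auto
  finally show ?thesis by (simp add: y(2) power_divide mult_ac)
qed

section \<open>Prime factors of Mersenne numbers\<close>

lemma harm_le_1_plus_ln:
  assumes "n \<ge> 1"
  shows "harm n \<le> 1 + ln (real n)"
  using euler_mascheroni_sequence_decreasing[of 1 n] assms by (simp add: harm_expand)

lemma sum_inverse_coprime_6_le:
  fixes Q :: "nat set" and n :: nat
  assumes Q: "\<And>q. q \<in> Q \<Longrightarrow> odd q \<and> \<not> 3 dvd q \<and> 3 < q \<and> q \<le> n" and n: "n \<ge> 1"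
  shows "(\<Sum>q\<in>Q. 1 / (real q - 1)) \<le> 5 / 12 * (1 + ln (real n))"
proof -
  let ?A = "(\<lambda>k::nat. 6 * k - 1) ` {1..n}" and ?B = "(\<lambda>k::nat. 6 * k + 1) ` {1..n}"
  let ?f = "\<lambda>q. 1 / (real q - 1)"
  have "Q \<subseteq> ?A \<union> ?B"
  proof
    fix q assume "q \<in> Q"
    then have q: "odd q" "\<not> 3 dvd q" "3 < q" "q \<le> n" using Q by auto
    then have "q mod 6 = 1 \<or> q mod 6 = 5" by presburger
    then show "q \<in> ?A \<union> ?B"
    proof
      assume "q mod 6 = 1"
      then have "q = 6 * (q div 6) + 1" by (metis div_mult_mod_eq mult.commute)
      then show ?thesis using q by (intro UnI2 image_eqI[of _ _ "q div 6"]) auto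
    next
      assume "q mod 6 = 5"
      then have "q = 6 * (q div 6 + 1) - 1" by presburger
      then show ?thesis using q by (intro UnI1 image_eqI[of _ _ "q div 6 + 1"]) auto
    qed
  qed
  then have "(\<Sum>q\<in>Q. ?f q) \<le> (\<Sum>q\<in>?A \<union> ?B. ?f q)" by (intro sum_mono2) auto
  also have "\<dots> \<le> (\<Sum>q\<in>?A. ?f q) + (\<Sum>q\<in>?B. ?f q)"
    by (subst sum.union_inter[symmetric]) (auto intro!: sum_nonneg)
  also have "(\<Sum>q\<in>?A. ?f q) = (\<Sum>k=1..n. ?f (6 * k - 1))"
    by (subst sum.reindex) (auto simp: inj_on_def)
  also have "\<dots> \<le> (\<Sum>k=1..n. 1 / 4 * inverse (real k))"
  proof (intro sum_mono)
    fix k assume "k \<in> {1..n}"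
    then have "real (6 * k - 1) - 1 \<ge> 4 * real k" "k \<ge> 1" by (auto simp: of_nat_diff)
    then show "?f (6 * k - 1) \<le> 1 / 4 * inverse (real k)" by (simp add: field_simps)
  qed
  also have "(\<Sum>q\<in>?B. ?f q) = (\<Sum>k=1..n. 1 / 6 * inverse (real k))"
    by (subst sum.reindex) (auto simp: inj_on_def field_simps intro!: sum.cong)
  also have "(\<Sum>k=1..n. 1 / 4 * inverse (real k)) + (\<Sum>k=1..n. 1 / 6 * inverse (real k)) = 5 / 12 * harm n"
    unfolding harm_def sum_distrib_left[symmetric] by simp
  also have "\<dots> \<le> 5 / 12 * (1 + ln n)" using harm_le_1_plus_ln[OF n] by simp
  finally show ?thesis by simp
qed

lemma sum_inverse_odd_primes_le:
  fixes Q :: "nat set" and n :: nat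
  assumes Q: "finite Q" "\<And>q. q \<in> Q \<Longrightarrow> prime q" "2 \<notin> Q" "card Q \<le> n" and n: "n \<ge> 1"
  shows "(\<Sum>q\<in>Q. 1 / (real q - 1)) \<le> 2 + 5 / 12 * ln (real n)"
proof -
  let ?f = "\<lambda>q. 1 / (real q - 1)" and ?small = "{q \<in> Q. 3 < q \<and> q \<le> n}" and ?large = "{q \<in> Q. 3 < q \<and> n < q}"
  have Q3: "q \<ge> 3" if "q \<in> Q" for q
  proof -
    have "q \<noteq> 2" using that Q(3) by auto
    then show ?thesis using prime_ge_2_nat[OF Q(2)[OF that]] by simp
  qed
  have "(\<Sum>q\<in>Q. ?f q) \<le> (\<Sum>q\<in>insert 3 (?small \<union> ?large). ?f q)"
    using Q(1) Q3 by (intro sum_mono2) force+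
  also have "\<dots> = ?f 3 + ((\<Sum>q\<in>?small. ?f q) + (\<Sum>q\<in>?large. ?f q))"
    using Q(1) by (simp, intro sum.union_disjoint) auto
  also have "(\<Sum>q\<in>?large. ?f q) \<le> (\<Sum>q\<in>?large. 1 / real n)"
  proof (intro sum_mono divide_left_mono)
    fix q assume "q \<in> ?large"
    then have "n + 1 \<le> q" by simp
    then have "real (n + 1) \<le> real q" by (simp only: of_nat_le_iff)
    then show "real n \<le> real q - 1" by simp
    with n show "0 < (real q - 1) * real n" by (intro mult_pos_pos) linarith+
  qed simp
  also have "\<dots> = real (card (?large)) / real n" by simp
  also have "\<dots> \<le> real n / real n"
  proof (intro divide_right_mono of_nat_mono)
    have "card (?large) \<le> card Q" using Q(1) by (intro card_mono) auto
    then show "card (?large) \<le> n" using Q(4) by (rule order_trans)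
  qed simp
  also have "(\<Sum>q\<in>?small. ?f q) \<le> 5 / 12 * (1 + ln (real n))"
  proof (rule sum_inverse_coprime_6_le[OF _ n])
    fix q assume q: "q \<in> ?small"
    then have "\<not> 2 dvd q" "\<not> 3 dvd q"
      using Q(2)[of q] primes_dvd_imp_eq[of 2 q] primes_dvd_imp_eq[of 3 q] by auto
    then show "odd q \<and> \<not> 3 dvd q \<and> 3 < q \<and> q \<le> n" using q by simp
  qed
  finally show ?thesis using n by (simp add: distrib_left)
qed

text \<open>Any exponent below \<open>1 / 2\<close> will do; \<open>5 / 12\<close> comes from primes above \<open>3\<close> being \<open>\<plusminus>1\<close> modulo \<open>6\<close>.\<close>

lemma prod_odd_primes_le:
  fixes Q :: "nat set" and n :: nat
  assumes Q: "finite Q" "\<And>q. q \<in> Q \<Longrightarrow> prime q" "2 \<notin> Q" "card Q \<le> n" and n: "n \<ge> 1"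
  shows "(\<Prod>q\<in>Q. 1 + 1 / (real q - 1)) \<le> exp 2 * real n powr (5 / 12)"
proof -
  have "(\<Prod>q\<in>Q. 1 + 1 / (real q - 1)) \<le> (\<Prod>q\<in>Q. exp (1 / (real q - 1)))"
  proof (intro prod_mono conjI exp_ge_add_one_self)
    fix q assume "q \<in> Q"
    from prime_gt_1_nat[OF Q(2)[OF this]] show "0 \<le> 1 + 1 / (real q - 1)" by simp
  qed
  also have "\<dots> = exp (\<Sum>q\<in>Q. 1 / (real q - 1))" using Q(1) by (simp add: exp_sum)
  also have "\<dots> \<le> exp (2 + 5 / 12 * ln (real n))"
    using sum_inverse_odd_primes_le[OF Q n] by simp
  also have "\<dots> = exp 2 * real n powr (5 / 12)" using n by (simp add: exp_add powr_def)
  finally show ?thesis .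
qed

lemma two_power_card_prime_factors_le:
  fixes n :: nat
  assumes "n > 0"
  shows "2 ^ card (prime_factors n) \<le> n"
proof -
  have "2 ^ card (prime_factors n) = (\<Prod>q\<in>prime_factors n. 2)" by simp
  also have "\<dots> \<le> \<Prod>(prime_factors n)"
    by (intro prod_mono) (auto intro: prime_ge_2_nat)
  also have "\<dots> \<le> n" using assms by (rule prod_prime_factors_le)
  finally show ?thesis .
qed

definition mersenne :: "nat \<Rightarrow> nat" where
  "mersenne j = 2 ^ j - 1"

lemma mersenne_pos: "j \<ge> 1 \<Longrightarrow> mersenne j > 0"
  using one_less_power[of "2::nat" j] by (simp add: mersenne_def)

lemma dvd_mersenne_iff_ord_dvd: "q dvd mersenne j \<longleftrightarrow> ord q 2 dvd j"
proof -
  have "q dvd mersenne j \<longleftrightarrow> [2 ^ j = 1] (mod q)"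
    unfolding mersenne_def using cong_altdef_nat[of 1 "2 ^ j" q] by (simp add: cong_sym_eq)
  then show ?thesis by (simp only: ord_divides)
qed

definition mersenne_prime_factors :: "nat \<Rightarrow> nat set" where
  "mersenne_prime_factors t = {q. prime q \<and> 1 \<le> ord q 2 \<and> ord q 2 \<le> t}"

lemma prime_factors_mersenne:
  assumes "j \<ge> 1"
  shows "prime_factors (mersenne j) = {q. prime q \<and> ord q 2 dvd j}"
  using mersenne_pos[OF assms] by (auto simp: prime_factors_dvd dvd_mersenne_iff_ord_dvd)

lemma mersenne_prime_factors_eq_UN:
  "mersenne_prime_factors t = (\<Union>j\<in>{1..t}. prime_factors (mersenne j))"
proof (intro equalityI subsetI)
  fix q assume "q \<in> mersenne_prime_factors t"
  then show "q \<in> (\<Union>j\<in>{1..t}. prime_factors (mersenne j))"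
    by (intro UN_I[of "ord q 2"]) (auto simp: mersenne_prime_factors_def prime_factors_mersenne)
next
  fix q assume "q \<in> (\<Union>j\<in>{1..t}. prime_factors (mersenne j))"
  then obtain j where j: "1 \<le> j" "j \<le> t" "prime q" "ord q 2 dvd j"
    by (auto simp: prime_factors_mersenne)
  then have "0 < ord q 2" "ord q 2 \<le> j" using dvd_pos_nat[of j] by (auto intro: dvd_imp_le)
  then show "q \<in> mersenne_prime_factors t"
    unfolding mersenne_prime_factors_def using j by (intro CollectI conjI) linarith+
qed

lemma finite_mersenne_prime_factors: "finite (mersenne_prime_factors t)"
  by (simp add: mersenne_prime_factors_eq_UN)

lemma mersenne_prime_factorsD: "q \<in> mersenne_prime_factors t \<Longrightarrow> prime q"
  by (simp add: mersenne_prime_factors_def)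

lemma card_mersenne_prime_factors_le: "card (mersenne_prime_factors t) \<le> t\<^sup>2"
proof -
  have "card (mersenne_prime_factors t) \<le> (\<Sum>j\<in>{1..t}. card (prime_factors (mersenne j)))"
    unfolding mersenne_prime_factors_eq_UN by (intro card_UN_le) auto
  also have "\<dots> \<le> (\<Sum>j\<in>{1..t}. t)"
  proof (intro sum_mono)
    fix j assume j: "j \<in> {1..t}"
    have "(2::nat) ^ card (prime_factors (mersenne j)) \<le> mersenne j"
      using j by (intro two_power_card_prime_factors_le mersenne_pos) simp
    also have "\<dots> < 2 ^ j" by (simp add: mersenne_def)
    finally show "card (prime_factors (mersenne j)) \<le> t" using j by simp
  qed
  finally show ?thesis by (simp add: power2_eq_square)
qed

lemma prod_mersenne_prime_factors_le:
  assumes "t \<ge> 1"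
  shows "(\<Prod>q\<in>mersenne_prime_factors t. 1 + 1 / (real q - 1)) \<le> exp 2 * real t powr (5 / 6)"
proof -
  have "2 \<notin> mersenne_prime_factors t"
    by (auto simp: mersenne_prime_factors_def)
  then have "(\<Prod>q\<in>mersenne_prime_factors t. 1 + 1 / (real q - 1)) \<le> exp 2 * real (t\<^sup>2) powr (5 / 12)"
    using assms finite_mersenne_prime_factors mersenne_prime_factorsD card_mersenne_prime_factors_le
    by (intro prod_odd_primes_le) auto
  also have "real (t\<^sup>2) powr (5 / 12) = real t powr (5 / 6)"
    using assms by (simp add: powr_powr flip: powr_numeral)
  finally show ?thesis .
qed

section \<open>The average of the totient ratio over Mersenne numbers\<close>

lemma inverse_eq_telescoping_sum:
  fixes e K :: nat
  assumes "1 \<le> e" "e \<le> K"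
  shows "1 / real e = (\<Sum>t=e..K. 1 / (real t * (real t + 1))) + 1 / (real K + 1)"
  using assms(2)
proof (induction K rule: dec_induct)
  case base
  have "1 / x = 1 / (x * (x + 1)) + 1 / (x + 1)" if "x > 0" for x :: real
    using that by (simp add: divide_simps)
  from this[of "real e"] show ?case using assms(1) by simp
next
  case (step n)
  have "1 / (real n + 1) = 1 / ((real n + 1) * (real n + 2)) + 1 / (real n + 2)"
    by (simp add: divide_simps)
  then show ?case using step by (simp add: add_ac)
qed

lemma sum_divide_le_partial_summation:
  fixes w :: "'a \<Rightarrow> real" and e :: "'a \<Rightarrow> nat" and F :: "nat \<Rightarrow> real"
  assumes "finite A" and "K \<ge> 1" and e: "\<And>x. x \<in> A \<Longrightarrow> 1 \<le> e x \<and> e x \<le> K"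
    and F: "\<And>t. 1 \<le> t \<Longrightarrow> t \<le> K \<Longrightarrow> (\<Sum>x | x \<in> A \<and> e x \<le> t. w x) \<le> F t"
  shows "(\<Sum>x\<in>A. w x / real (e x)) \<le> (\<Sum>t=1..K. F t / (real t * (real t + 1))) + F K / (real K + 1)"
proof -
  have "(\<Sum>x\<in>A. w x / real (e x))
      = (\<Sum>x\<in>A. (\<Sum>t | t \<in> {1..K} \<and> e x \<le> t. w x / (real t * (real t + 1))) + w x / (real K + 1))"
  proof (intro sum.cong refl)
    fix x assume "x \<in> A"
    then have ex: "1 \<le> e x" "e x \<le> K" using e by auto
    then have "{t. t \<in> {1..K} \<and> e x \<le> t} = {e x..K}" by auto
    moreover have "w x / real (e x) = w x * (1 / real (e x))" by simp
    ultimately show "w x / real (e x)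
        = (\<Sum>t | t \<in> {1..K} \<and> e x \<le> t. w x / (real t * (real t + 1))) + w x / (real K + 1)"
      unfolding inverse_eq_telescoping_sum[OF ex] by (simp add: distrib_left sum_distrib_left)
  qed
  also have "\<dots> = (\<Sum>t=1..K. \<Sum>x | x \<in> A \<and> e x \<le> t. w x / (real t * (real t + 1)))
      + (\<Sum>x\<in>A. w x / (real K + 1))"
    using assms(1) by (simp add: sum.distrib sum.swap_restrict)
  also have "\<dots> = (\<Sum>t=1..K. (\<Sum>x | x \<in> A \<and> e x \<le> t. w x) / (real t * (real t + 1)))
      + (\<Sum>x | x \<in> A \<and> e x \<le> K. w x) / (real K + 1)"
  proof -
    have "{x. x \<in> A \<and> e x \<le> K} = A" using e by auto
    then show ?thesis by (simp add: sum_divide_distrib)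
  qed
  also have "\<dots> \<le> (\<Sum>t=1..K. F t / (real t * (real t + 1))) + F K / (real K + 1)"
    using F \<open>K \<ge> 1\<close> by (intro add_mono sum_mono divide_right_mono) auto
  finally show ?thesis .
qed

lemma card_multiples: "card {j \<in> {1..K}. e dvd j} = K div e" for e K :: nat
proof (cases "e = 0")
  case True
  then have "{j \<in> {1..K}. e dvd j} = {}" by auto
  then show ?thesis using True by (simp only: card.empty) simp
next
  case False
  then have "{j \<in> {1..K}. e dvd j} = (\<lambda>i. e * i) ` {1..K div e}"
    by (auto simp: less_eq_div_iff_mult_less_eq mult.commute Suc_le_eq)
  moreover have "inj_on (\<lambda>i. e * i) {1..K div e}" using False by (simp add: inj_on_def)
  ultimately show ?thesis by (simp add: card_image)
qed

text \<open>\<open>mersenne_period D\<close> is \<open>0\<close> if \<open>2 \<in> D\<close>, and then divides no exponent \<open>j \<ge> 1\<close>, as it should.\<close>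

definition mersenne_period :: "nat set \<Rightarrow> nat" where
  "mersenne_period D = Lcm ((\<lambda>q. ord q 2) ` D)"

lemma subset_prime_factors_mersenne_iff:
  assumes "j \<ge> 1" "\<And>q. q \<in> D \<Longrightarrow> prime q"
  shows "D \<subseteq> prime_factors (mersenne j) \<longleftrightarrow> mersenne_period D dvd j"
  using assms by (auto simp: prime_factors_mersenne mersenne_period_def Lcm_dvd_iff)

lemma sum_totient_ratio_mersenne_eq:
  "(\<Sum>j=1..K. totient_ratio (mersenne j))
    = (\<Sum>D\<in>Pow (mersenne_prime_factors K). (\<Prod>q\<in>D. 1 / (real q - 1)) * real (K div mersenne_period D))"
proof -
  let ?Q = "mersenne_prime_factors K" and ?w = "\<lambda>D. \<Prod>q\<in>D. 1 / (real q - 1)"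
  have "(\<Sum>j=1..K. totient_ratio (mersenne j)) = (\<Sum>j=1..K. \<Sum>D | D \<in> Pow ?Q \<and> mersenne_period D dvd j. ?w D)"
  proof (intro sum.cong refl)
    fix j assume j: "j \<in> {1..K}"
    then have "prime_factors (mersenne j) \<subseteq> ?Q" unfolding mersenne_prime_factors_eq_UN by blast
    then have "{D. D \<in> Pow ?Q \<and> mersenne_period D dvd j} = Pow (prime_factors (mersenne j))"
      using j subset_prime_factors_mersenne_iff[of j] mersenne_prime_factorsD by auto blast+
    moreover have "totient_ratio (mersenne j) = (\<Sum>D\<in>Pow (prime_factors (mersenne j)). ?w D)"
      using j by (subst totient_ratio_eq_prod) (auto simp: sum_prod_Pow mersenne_pos)
    ultimately show "totient_ratio (mersenne j) = (\<Sum>D | D \<in> Pow ?Q \<and> mersenne_period D dvd j. ?w D)"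
      by (simp only:)
  qed
  also have "\<dots> = (\<Sum>D\<in>Pow ?Q. \<Sum>j | j \<in> {1..K} \<and> mersenne_period D dvd j. ?w D)"
    using finite_mersenne_prime_factors by (intro sum.swap_restrict) auto
  also have "\<dots> = (\<Sum>D\<in>Pow ?Q. ?w D * real (K div mersenne_period D))"
    using card_multiples[of K] by (intro sum.cong refl) (simp add: mult.commute)
  finally show ?thesis .
qed

lemma prod_inverse_prime_minus_1_nonneg:
  fixes D :: "nat set"
  assumes "\<And>q. q \<in> D \<Longrightarrow> prime q"
  shows "0 \<le> (\<Prod>q\<in>D. 1 / (real q - 1))"
  using prime_gt_1_nat[OF assms] by (intro prod_nonneg) force

lemma sum_prod_mersenne_period_le:
  assumes "t \<ge> 1"
  shows "(\<Sum>D | D \<subseteq> mersenne_prime_factors K \<and> 1 \<le> mersenne_period D \<and> mersenne_period D \<le> t.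
      \<Prod>q\<in>D. 1 / (real q - 1)) \<le> exp 2 * real t powr (5 / 6)"
proof -
  have "{D. D \<subseteq> mersenne_prime_factors K \<and> 1 \<le> mersenne_period D \<and> mersenne_period D \<le> t}
      \<subseteq> Pow (mersenne_prime_factors t)"
  proof safe
    fix D q
    assume D: "D \<subseteq> mersenne_prime_factors K" "1 \<le> mersenne_period D" "mersenne_period D \<le> t" and q: "q \<in> D"
    have "ord q 2 dvd mersenne_period D" unfolding mersenne_period_def using q by (intro dvd_Lcm) auto
    then have "ord q 2 \<le> t" using D(2,3) by (auto dest: dvd_imp_le)
    then show "q \<in> mersenne_prime_factors t" using D(1) q by (auto simp: mersenne_prime_factors_def)
  qed
  moreover have "0 \<le> (\<Prod>q\<in>D. 1 / (real q - 1))" if "D \<in> Pow (mersenne_prime_factors t)" for D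
    using that mersenne_prime_factorsD by (intro prod_inverse_prime_minus_1_nonneg) blast
  ultimately have "(\<Sum>D | D \<subseteq> mersenne_prime_factors K \<and> 1 \<le> mersenne_period D \<and> mersenne_period D \<le> t.
      \<Prod>q\<in>D. 1 / (real q - 1)) \<le> (\<Sum>D\<in>Pow (mersenne_prime_factors t). \<Prod>q\<in>D. 1 / (real q - 1))"
    by (intro sum_mono2) (auto simp: finite_mersenne_prime_factors)
  also have "\<dots> \<le> exp 2 * real t powr (5 / 6)"
    unfolding sum_prod_Pow[OF finite_mersenne_prime_factors]
    using assms by (rule prod_mersenne_prime_factors_le)
  finally show ?thesis .
qed

lemma sum_totient_ratio_mersenne_le_partial_summation:
  assumes K: "K \<ge> 1"
  defines "F \<equiv> \<lambda>t :: nat. exp 2 * real t powr (5 / 6)"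
  shows "(\<Sum>j=1..K. totient_ratio (mersenne j))
    \<le> real K * ((\<Sum>t=1..K. F t / (real t * (real t + 1))) + F K / (real K + 1))"
proof -
  let ?Q = "mersenne_prime_factors K" and ?w = "\<lambda>D. \<Prod>q\<in>D. 1 / (real q - 1)"
  let ?A = "{D. D \<subseteq> ?Q \<and> 1 \<le> mersenne_period D \<and> mersenne_period D \<le> K}"
  have finite: "finite (Pow ?Q)" using finite_mersenne_prime_factors by simp
  have w: "0 \<le> ?w D" if "D \<subseteq> ?Q" for D
    using that mersenne_prime_factorsD by (intro prod_inverse_prime_minus_1_nonneg) blast
  have "(\<Sum>j=1..K. totient_ratio (mersenne j)) = (\<Sum>D\<in>Pow ?Q. ?w D * real (K div mersenne_period D))"
    by (rule sum_totient_ratio_mersenne_eq)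
  also have "\<dots> = (\<Sum>D\<in>?A. ?w D * real (K div mersenne_period D))"
  proof (intro sum.mono_neutral_right finite ballI)
    fix D assume "D \<in> Pow ?Q - ?A"
    then have "mersenne_period D = 0 \<or> K < mersenne_period D" by auto
    then show "?w D * real (K div mersenne_period D) = 0" by auto
  qed auto
  also have "\<dots> \<le> (\<Sum>D\<in>?A. real K * (?w D / real (mersenne_period D)))"
  proof (intro sum_mono)
    fix D assume "D \<in> ?A"
    then have "?w D * real (K div mersenne_period D) \<le> ?w D * (real K / real (mersenne_period D))"
      by (intro mult_left_mono of_nat_div_le_of_nat w) auto
    then show "?w D * real (K div mersenne_period D) \<le> real K * (?w D / real (mersenne_period D))"
      by (simp add: mult.commute)
  qed
  also have "\<dots> = real K * (\<Sum>D\<in>?A. ?w D / real (mersenne_period D))" by (simp only: sum_distrib_left)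
  also have "(\<Sum>D\<in>?A. ?w D / real (mersenne_period D))
      \<le> (\<Sum>t=1..K. F t / (real t * (real t + 1))) + F K / (real K + 1)"
  proof (rule sum_divide_le_partial_summation)
    show "finite ?A" using finite by (rule finite_subset[rotated]) auto
    fix t :: nat assume t: "1 \<le> t" "t \<le> K"
    have "{D. D \<in> ?A \<and> mersenne_period D \<le> t}
        = {D. D \<subseteq> ?Q \<and> 1 \<le> mersenne_period D \<and> mersenne_period D \<le> t}" using t by auto
    then show "(\<Sum>D | D \<in> ?A \<and> mersenne_period D \<le> t. ?w D) \<le> F t"
      using sum_prod_mersenne_period_le[OF t(1), of K] by (simp only: F_def)
  qed (use K in auto)
  finally show ?thesis by (simp add: mult_left_mono)
qed

text \<open>Erdos: after expanding the products, a set \<open>D\<close> of primes contributes to one out of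
  \<open>mersenne_period D\<close> exponents, and only few sets of primes have a small period.\<close>

theorem sum_totient_ratio_mersenne_le:
  "\<exists>C>0. \<forall>K. (\<Sum>j=1..K. totient_ratio (mersenne j)) \<le> C * real K"
proof -
  define Z where "Z = (\<Sum>t. real t powr (- 7 / 6))"
  have summable: "summable (\<lambda>t. real t powr (- 7 / 6))" by (simp add: summable_real_powr_iff)
  have "Z \<ge> 0" unfolding Z_def by (intro suminf_nonneg summable) simp
  have "(\<Sum>j=1..K. totient_ratio (mersenne j)) \<le> exp 2 * (Z + 1) * real K" for K
  proof (cases "K = 0")
    case False
    let ?F = "\<lambda>t :: nat. exp 2 * real t powr (5 / 6)"
    have F_term: "?F t / (real t * (real t + 1)) \<le> exp 2 * real t powr (- 7 / 6)" if "t \<ge> 1" for t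
    proof -
      have "?F t / (real t * (real t + 1)) \<le> ?F t / (real t powr 2)"
        using that by (intro divide_left_mono) (auto simp: power2_eq_square)
      also have "\<dots> = exp 2 * real t powr (- 7 / 6)"
        by (simp flip: powr_diff times_divide_eq_right del: powr_numeral)
      finally show ?thesis .
    qed
    have "(\<Sum>t=1..K. ?F t / (real t * (real t + 1))) \<le> (\<Sum>t=1..K. exp 2 * real t powr (- 7 / 6))"
      by (intro sum_mono F_term) simp
    also have "\<dots> = exp 2 * (\<Sum>t=1..K. real t powr (- 7 / 6))" by (simp only: sum_distrib_left)
    also have "\<dots> \<le> exp 2 * Z"
      unfolding Z_def by (intro mult_left_mono sum_le_suminf summable) auto
    finally have main_term: "(\<Sum>t=1..K. ?F t / (real t * (real t + 1))) \<le> exp 2 * Z" .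
    have "real K powr (5 / 6) \<le> real K powr 1" using False by (intro powr_mono) auto
    then have "?F K / (real K + 1) \<le> exp 2 * 1"
      using False by (simp add: divide_le_eq)
    with main_term have "(\<Sum>t=1..K. ?F t / (real t * (real t + 1))) + ?F K / (real K + 1) \<le> exp 2 * (Z + 1)"
      by (simp add: distrib_left)
    then have "real K * ((\<Sum>t=1..K. ?F t / (real t * (real t + 1))) + ?F K / (real K + 1))
        \<le> real K * (exp 2 * (Z + 1))"
      by (intro mult_left_mono) auto
    with sum_totient_ratio_mersenne_le_partial_summation[of K] False show ?thesis
      by (simp only: mult.commute[of "exp 2 * (Z + 1)"]) linarith
  qed simp
  moreover have "exp 2 * (Z + 1) > 0" using \<open>Z \<ge> 0\<close> by (intro mult_pos_pos) auto
  ultimately show ?thesis by blast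
qed

section \<open>Chebyshev's lower bound\<close>

lemma real_div_in_Ints_iff: "n \<noteq> 0 \<Longrightarrow> real m / real n \<in> \<int> \<longleftrightarrow> n dvd m"
  using of_int_div_of_int_in_Ints_iff[of "int m" "int n", where 'a = real] by simp

text \<open>The entries \<open>1 / ((n + 1) * (n choose k))\<close> of Leibniz's harmonic triangle are differences of
  neighbouring entries, so \<open>Lcm {1..n + 1}\<close> clears all denominators of row \<open>n\<close>.\<close>

lemma inverse_Suc_times_binomial_diff:
  assumes "k \<le> n"
  shows "1 / real (Suc (Suc n) * (Suc n choose Suc k))
    = 1 / real (Suc n * (n choose k)) - 1 / real (Suc (Suc n) * (Suc n choose k))"
proof -
  define a b c
    where "a = real (n choose k)" and "b = real (Suc n choose k)" and "c = real (Suc n choose Suc k)"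
  have pos: "a > 0" "b > 0" "c > 0" using assms by (simp_all add: a_def b_def c_def del: binomial_Suc_Suc)
  have "real (Suc k * (Suc n choose Suc k)) = real (Suc n * (n choose k))"
    by (simp only: Suc_times_binomial)
  then have "(real n + 1) * a = (real k + 1) * c"
    by (simp add: a_def c_def algebra_simps del: binomial_Suc_Suc)
  then have inverse_c: "1 / c = (real k + 1) / ((real n + 1) * a)"
    using pos by (simp add: frac_eq_eq)
  have "real ((Suc n - k) * (Suc n choose k)) = real (Suc n * (n choose k))"
    by (simp only: binomial_absorb_comp diff_Suc_1)
  then have "real (Suc n) * a = real (Suc n - k) * b" by (simp only: of_nat_mult a_def b_def)
  then have "(real n + 1) * a = (real n + 1 - real k) * b" using assms by (simp add: of_nat_diff add.commute)
  then have inverse_b: "1 / b = (real n + 1 - real k) / ((real n + 1) * a)"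
    using pos by (subst frac_eq_eq) auto
  have "(1 / c) / (real n + 2) = 1 / ((real n + 1) * a) - (1 / b) / (real n + 2)"
    using pos(1) unfolding inverse_b inverse_c by (simp add: divide_simps)
  then show ?thesis by (simp add: a_def b_def c_def algebra_simps del: binomial_Suc_Suc)
qed

lemma Suc_times_binomial_dvd_Lcm:
  fixes n k :: nat
  assumes "k \<le> n"
  shows "Suc n * (n choose k) dvd Lcm {1..Suc n}"
  using assms
proof (induction k arbitrary: n)
  case 0
  then show ?case by (auto intro: dvd_Lcm)
next
  case (Suc k)
  then obtain m where n: "n = Suc m" and km: "k \<le> m" by (cases n) auto
  define d where "d = Lcm {1..Suc n}"
  have "Suc m * (m choose k) dvd Lcm {1..Suc m}" using Suc.IH km by blast
  also have "\<dots> dvd d" unfolding n d_def by (rule Lcm_subset) auto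
  finally have above: "real d / real (Suc m * (m choose k)) \<in> \<int>"
    using km by (subst real_div_in_Ints_iff) auto
  have "Suc n * (n choose k) dvd d" unfolding d_def using Suc.IH Suc.prems by simp
  then have left: "real d / real (Suc n * (n choose k)) \<in> \<int>"
    using Suc.prems by (subst real_div_in_Ints_iff) auto
  have "real d * (1 / real (Suc n * (n choose Suc k)))
      = real d * (1 / real (Suc m * (m choose k)) - 1 / real (Suc n * (n choose k)))"
    unfolding n inverse_Suc_times_binomial_diff[OF km] ..
  then have "real d / real (Suc n * (n choose Suc k)) \<in> \<int>"
    using Ints_diff[OF above left] by (simp only: right_diff_distrib times_divide_eq_right mult_1_right)
  then show ?case
    unfolding d_def using Suc.prems by (subst (asm) real_div_in_Ints_iff) auto
qed

lemma Lcm_upto_le_power_card_primes: "Lcm {1..N} \<le> N ^ card (primes_le (real N))"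
proof (cases "N = 0")
  case False
  have "\<exists>j. p ^ j \<le> N \<and> N < p ^ (j + 1)" if "prime p" for p
    using ex_power_ivl1[of p N] prime_ge_2_nat[OF that] False by simp
  then obtain e where e: "\<And>p. prime p \<Longrightarrow> p ^ e p \<le> N" "\<And>p. prime p \<Longrightarrow> N < p ^ (e p + 1)"
    by metis
  have "n dvd (\<Prod>p\<in>primes_le (real N). p ^ e p)" if n: "n \<in> {1..N}" for n
  proof -
    have "n = (\<Prod>p\<in>prime_factors n. p ^ multiplicity p n)" using n by (intro prime_factorization_nat) simp
    also have "\<dots> dvd (\<Prod>p\<in>prime_factors n. p ^ e p)"
    proof (intro prod_dvd_prod le_imp_power_dvd)
      fix p assume "p \<in> prime_factors n"
      then have p: "prime p" by (rule in_prime_factors_imp_prime)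
      have "p ^ multiplicity p n \<le> n" using n by (intro dvd_imp_le multiplicity_dvd) simp
      also have "\<dots> \<le> N" using n by simp
      also have "\<dots> < p ^ (e p + 1)" by (rule e(2)[OF p])
      finally have "multiplicity p n < e p + 1"
        using prime_gt_1_nat[OF p] by (rule power_less_imp_less_exp[rotated])
      then show "multiplicity p n \<le> e p" by simp
    qed
    also have "\<dots> dvd (\<Prod>p\<in>primes_le (real N). p ^ e p)"
      using n by (intro prod_dvd_prod_subset finite_primes_le)
        (auto simp: primes_le_def prime_factors_dvd dest!: dvd_imp_le)
    finally show ?thesis .
  qed
  then have "Lcm {1..N} dvd (\<Prod>p\<in>primes_le (real N). p ^ e p)" by (rule Lcm_least)
  moreover have "0 < p ^ e p" if "p \<in> primes_le (real N)" for p
    using prime_gt_0_nat[OF primes_leD[OF that]] by simp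
  then have "0 < (\<Prod>p\<in>primes_le (real N). p ^ e p)" by (rule prod_pos)
  ultimately have "Lcm {1..N} \<le> (\<Prod>p\<in>primes_le (real N). p ^ e p)" by (rule dvd_imp_le)
  also have "\<dots> \<le> (\<Prod>p\<in>primes_le (real N). N)"
    using e(1) by (intro prod_mono) (auto dest: primes_leD)
  finally show ?thesis by simp
next
  case True
  have "primes_le 0 = {}" by (auto simp: primes_le_def)
  then show ?thesis using True by simp
qed

lemma ln_4_ge_1: "ln (4 :: real) \<ge> 1"
proof -
  have "ln (4 :: real) = 2 * ln 2" using ln_realpow[of 2 2] by simp
  then show ?thesis using ln2_ge_two_thirds by simp
qed

theorem card_primes_le_ge:
  fixes N :: nat
  assumes "N \<ge> 3"
  shows "real N / (6 * ln N) \<le> real (card (primes_le (real N)))"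
proof -
  define n where "n = (N - 1) div 2"
  have n: "n > 0" "2 * n + 1 \<le> N" "N \<le> 2 * n + 2" using assms by (auto simp: n_def)
  have "Suc (2 * n) * ((2 * n) choose n) dvd Lcm {1..Suc (2 * n)}" by (rule Suc_times_binomial_dvd_Lcm) simp
  also have "\<dots> dvd Lcm {1..N}" using n(2) by (intro Lcm_subset) auto
  finally have "Suc (2 * n) * ((2 * n) choose n) \<le> Lcm {1..N}"
    by (rule dvd_imp_le) (auto intro!: Nat.gr0I simp: Lcm_0_iff)
  also have "\<dots> \<le> N ^ card (primes_le (real N))" by (rule Lcm_upto_le_power_card_primes)
  finally have "real (Suc (2 * n) * ((2 * n) choose n)) \<le> real (N ^ card (primes_le (real N)))"
    by (simp only: of_nat_le_iff)
  moreover have "4 ^ n \<le> real (Suc (2 * n) * ((2 * n) choose n))"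
    using central_binomial_lower_bound[OF n(1)] n(1) by (simp add: field_simps)
  ultimately have "ln (4 ^ n) \<le> ln (real N ^ card (primes_le (real N)))"
    using assms by (intro ln_mono) auto
  then have "real n * ln 4 \<le> real (card (primes_le (real N))) * ln N"
    using assms by (simp add: ln_realpow)
  moreover have "real n * 1 \<le> real n * ln 4" by (intro mult_left_mono ln_4_ge_1) simp
  moreover have "real N / 6 \<le> real n" using n assms by linarith
  ultimately have "real N / 6 \<le> real (card (primes_le (real N))) * ln N" by linarith
  then show ?thesis using assms by (simp add: field_simps)
qed

section \<open>Romanoff's theorem\<close>

definition romanoff_numbers :: "nat set" where
  "romanoff_numbers = {n. odd n \<and> (\<exists>p k. prime p \<and> 0 < k \<and> n = p + 2 ^ k)}"

lemma card_squared_le_card_collisions: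
  fixes f :: "'a \<Rightarrow> 'b"
  assumes X: "finite X"
  shows "(real (card X))\<^sup>2 \<le> real (card {(x, y). x \<in> X \<and> y \<in> X \<and> f x = f y}) * real (card (f ` X))"
proof -
  define fibre where "fibre v = {x \<in> X. f x = v}" for v
  have "card X = (\<Sum>v\<in>f ` X. card (fibre v))"
    unfolding fibre_def using X sum.group[of X "f ` X" f "\<lambda>_. 1::nat"] by simp
  then have "(real (card X))\<^sup>2 = (\<Sum>v\<in>f ` X. real (card (fibre v)))\<^sup>2" by simp
  also have "\<dots> \<le> (\<Sum>v\<in>f ` X. (real (card (fibre v)))\<^sup>2) * real (card (f ` X))"
    by (rule sum_squared_le_sum_of_squares)
  also have "(\<Sum>v\<in>f ` X. (real (card (fibre v)))\<^sup>2) = real (\<Sum>v\<in>f ` X. card (fibre v \<times> fibre v))"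
    by (simp add: card_cartesian_product power2_eq_square)
  also have "(\<Sum>v\<in>f ` X. card (fibre v \<times> fibre v)) = card (\<Union>v\<in>f ` X. fibre v \<times> fibre v)"
    using X by (intro card_UN_disjoint[symmetric]) (auto simp: fibre_def)
  also have "(\<Union>v\<in>f ` X. fibre v \<times> fibre v) = {(x, y). x \<in> X \<and> y \<in> X \<and> f x = f y}"
    by (auto simp: fibre_def)
  finally show ?thesis .
qed

definition prime_collisions :: "nat \<Rightarrow> nat \<Rightarrow> nat \<Rightarrow> (nat \<times> nat) set" where
  "prime_collisions N k l = {(p, q). p < N \<and> q < N \<and> prime p \<and> prime q \<and> p + 2 ^ k = q + 2 ^ l}"

lemma finite_prime_collisions: "finite (prime_collisions N k l)"
  by (rule finite_subset[of _ "{..<N} \<times> {..<N}"]) (auto simp: prime_collisions_def)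

lemma card_prime_collisions_commute: "card (prime_collisions N k l) = card (prime_collisions N l k)"
  by (rule bij_betw_same_card[of "\<lambda>(p, q). (q, p)"], rule bij_betwI[where g = "\<lambda>(p, q). (q, p)"])
    (auto simp: prime_collisions_def)

lemma card_prime_collisions_diagonal_le:
  assumes "N \<ge> 2"
  shows "real (card (prime_collisions N k k)) \<le> 12 * (real N / ln N)"
proof -
  have "prime_collisions N k k \<subseteq> (\<lambda>p. (p, p)) ` {p. p < N \<and> prime p}" by (auto simp: prime_collisions_def)
  then have "card (prime_collisions N k k) \<le> card {p. p < N \<and> prime p}" by (rule surj_card_le[rotated]) auto
  also have "real (card {p. p < N \<and> prime p}) \<le> 12 * (real N / ln N)"
    using card_prime_linear_le[of 1 N 0] assms by (simp add: totient_ratio_def)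
  finally show ?thesis by simp
qed

lemma card_prime_collisions_le:
  assumes kl: "1 \<le> l" "l < k" and N: "N \<ge> 2"
  shows "real (card (prime_collisions N k l)) \<le> 576 * (real N / (ln N)\<^sup>2) * totient_ratio (mersenne (k - l))"
proof -
  let ?H = "2 ^ l * mersenne (k - l)"
  have H: "2 ^ k = 2 ^ l + ?H"
    using kl(2) by (simp add: mersenne_def diff_mult_distrib2 flip: power_add)
  have "prime_collisions N k l \<subseteq> (\<lambda>p. (p, p + ?H)) ` {p. p < N \<and> prime p \<and> prime (p + ?H)}"
    by (auto simp: prime_collisions_def H)
  then have "card (prime_collisions N k l) \<le> card {p. p < N \<and> prime p \<and> prime (p + ?H)}"
    by (rule surj_card_le[rotated]) auto
  then have "real (card (prime_collisions N k l)) \<le> real (card {p. p < N \<and> prime p \<and> prime (p + ?H)})" by simp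
  also have "\<dots> \<le> 288 * totient_ratio ?H * (real N / (ln N)\<^sup>2)"
    using kl N mersenne_pos[of "k - l"] by (intro card_prime_pairs_le) auto
  also have "\<dots> \<le> 288 * (2 * totient_ratio (mersenne (k - l))) * (real N / (ln N)\<^sup>2)"
  proof (intro mult_right_mono mult_left_mono)
    have "totient_ratio ?H \<le> totient_ratio (2 ^ l) * totient_ratio (mersenne (k - l))"
      by (rule totient_ratio_mult_le)
    also have "\<dots> \<le> 2 * totient_ratio (mersenne (k - l))"
      by (intro mult_right_mono totient_ratio_power_2_le totient_ratio_nonneg)
    finally show "totient_ratio ?H \<le> 2 * totient_ratio (mersenne (k - l))" .
  qed simp_all
  finally show ?thesis by (simp add: mult_ac)
qed

lemma sum_square_symmetric:
  fixes c :: "nat \<Rightarrow> nat \<Rightarrow> 'a :: comm_semiring_1"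
  assumes "\<And>k l. c k l = c l k"
  shows "(\<Sum>k=1..K. \<Sum>l=1..K. c k l) = (\<Sum>k=1..K. c k k) + 2 * (\<Sum>k=1..K. \<Sum>l=1..<k. c k l)"
proof (induction K)
  case (Suc K)
  have "(\<Sum>k=1..K. c k (Suc K)) = (\<Sum>l=1..<Suc K. c (Suc K) l)"
    by (intro sum.cong assms) auto
  moreover have "(\<Sum>l=1..K. c (Suc K) l) = (\<Sum>l=1..<Suc K. c (Suc K) l)"
    by (intro sum.cong) auto
  ultimately show ?case
    using Suc by (simp add: sum.distrib distrib_left mult_2 add_ac del: sum.op_ivl_Suc)
qed simp

lemma sum_card_prime_collisions_le:
  fixes N K :: nat and C :: real
  assumes N: "N \<ge> 2" and K: "real K \<le> 2 * ln N"
    and C: "\<And>K. (\<Sum>j=1..K. totient_ratio (mersenne j)) \<le> C * real K"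
  shows "(\<Sum>k=1..K. \<Sum>l=1..K. real (card (prime_collisions N k l))) \<le> (24 + 4608 * C) * real N"
proof -
  let ?c = "\<lambda>k l. real (card (prime_collisions N k l))"
  define W where "W = 576 * (real N / (ln N)\<^sup>2)"
  have "ln N > 0" using N by simp
  have "C * real 1 \<ge> 0" using C[of 1] totient_ratio_nonneg[of "mersenne 1"] by simp
  then have "C \<ge> 0" by simp
  have "(\<Sum>l=1..<k. ?c k l) \<le> W * (C * real K)" if k: "k \<in> {1..K}" for k
  proof -
    have "(\<Sum>l=1..<k. ?c k l) \<le> (\<Sum>l=1..<k. W * totient_ratio (mersenne (k - l)))"
      unfolding W_def using N by (intro sum_mono card_prime_collisions_le) auto
    also have "\<dots> = W * (\<Sum>j=1..<k. totient_ratio (mersenne j))"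
      unfolding sum_distrib_left by (subst sum.atLeastLessThan_rev) simp
    also have "\<dots> \<le> W * (C * real K)"
    proof (intro mult_left_mono order_trans[OF _ C])
      show "(\<Sum>j=1..<k. totient_ratio (mersenne j)) \<le> (\<Sum>j=1..K. totient_ratio (mersenne j))"
        using k by (intro sum_mono2 totient_ratio_nonneg) auto
    qed (simp add: W_def)
    finally show ?thesis .
  qed
  then have off_diagonal: "(\<Sum>k=1..K. \<Sum>l=1..<k. ?c k l) \<le> real K * (W * (C * real K))"
    using sum_mono[of "{1..K}" "\<lambda>k. \<Sum>l=1..<k. ?c k l" "\<lambda>_. W * (C * real K)"] by simp
  have diagonal: "(\<Sum>k=1..K. ?c k k) \<le> real K * (12 * (real N / ln N))"
    using sum_mono[of "{1..K}" "\<lambda>k. ?c k k" "\<lambda>_. 12 * (real N / ln N)"]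
      card_prime_collisions_diagonal_le[OF N] by simp
  have "(\<Sum>k=1..K. \<Sum>l=1..K. ?c k l) = (\<Sum>k=1..K. ?c k k) + 2 * (\<Sum>k=1..K. \<Sum>l=1..<k. ?c k l)"
    by (intro sum_square_symmetric) (simp add: card_prime_collisions_commute)
  also have "\<dots> \<le> real K * (12 * (real N / ln N)) + 2 * (real K * (W * (C * real K)))"
    using diagonal off_diagonal by (intro add_mono mult_left_mono) auto
  also have "\<dots> = 12 * (real N / ln N) * real K + 2 * W * C * (real K)\<^sup>2"
    by (simp add: power2_eq_square)
  also have "\<dots> \<le> 12 * (real N / ln N) * (2 * ln N) + 2 * W * C * (2 * ln N)\<^sup>2"
    using K \<open>ln N > 0\<close> \<open>C \<ge> 0\<close> by (intro add_mono mult_left_mono power_mono) (auto simp: W_def)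
  also have "\<dots> = (24 + 4608 * C) * real N"
    using \<open>ln N > 0\<close> by (simp add: W_def field_simps power2_eq_square)
  finally show ?thesis .
qed

lemma card_collisions_le_sum_prime_collisions:
  assumes A: "finite A" "\<And>p. p \<in> A \<Longrightarrow> prime p \<and> p < N"
  defines "f \<equiv> \<lambda>(p, k). p + 2 ^ k :: nat"
  shows "card {(x, y). x \<in> A \<times> {1..K} \<and> y \<in> A \<times> {1..K} \<and> f x = f y}
    \<le> (\<Sum>k=1..K. \<Sum>l=1..K. card (prime_collisions N k l))"
proof -
  let ?E = "{(x, y). x \<in> A \<times> {1..K} \<and> y \<in> A \<times> {1..K} \<and> f x = f y}"
  let ?C = "\<lambda>(k, l). prime_collisions N k l"
  have "card ?E \<le> card (Sigma ({1..K} \<times> {1..K}) ?C)"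
  proof (rule card_inj_on_le[where f = "\<lambda>((p, k), (q, l)). ((k, l), (p, q))"])
    show "(\<lambda>((p, k), (q, l)). ((k, l), (p, q))) ` ?E \<subseteq> Sigma ({1..K} \<times> {1..K}) ?C"
      using A(2) by (auto simp: prime_collisions_def f_def)
  qed (auto simp: inj_on_def finite_prime_collisions)
  also have "\<dots> = (\<Sum>u\<in>{1..K} \<times> {1..K}. card (?C u))"
    by (intro card_SigmaI) (auto simp: finite_prime_collisions)
  also have "\<dots> = (\<Sum>k=1..K. \<Sum>l=1..K. card (prime_collisions N k l))"
    by (simp add: sum.cartesian_product case_prod_unfold)
  finally show ?thesis .
qed

lemma power_2_bracket:
  fixes N :: nat
  assumes "N \<ge> 8"
  obtains K where "2 ^ K \<le> N" "N < 2 ^ (K + 1)" "ln N / 2 \<le> real K" "real K \<le> 2 * ln N"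
proof -
  obtain K where K: "2 ^ K \<le> N" "N < 2 ^ (K + 1)" using ex_power_ivl1[of 2 N] assms by auto
  have ln2: "2/3 \<le> ln (2::real)" "ln (2::real) \<le> 1" using ln2_ge_two_thirds ln_le_minus_one[of 2] by auto
  have "real (2 ^ K) \<le> real N" "real N \<le> real (2 ^ (K + 1))" "real (2 ^ 3) \<le> real N"
    using K assms by (simp_all only: of_nat_le_iff less_imp_le) simp
  then have "ln (real (2 ^ K)) \<le> ln (real N)" "ln (real N) \<le> ln (real (2 ^ (K + 1)))"
    "ln (real (2 ^ 3)) \<le> ln (real N)"
    using assms by (auto intro!: ln_mono simp del: of_nat_power power_Suc)
  moreover have "ln (8::real) = 3 * ln 2" using ln_realpow[of 2 3] by simp
  ultimately have lnN: "real K * ln 2 \<le> ln N" "ln N \<le> (real K + 1) * ln 2" "3 * ln 2 \<le> ln N"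
    by (simp_all add: ln_realpow ln_mult add.commute distrib_right)
  have "real K * (2/3) \<le> real K * ln 2" using ln2 by (intro mult_left_mono) auto
  then have upper: "real K \<le> 2 * ln N" using lnN(1) by (simp add: field_simps)
  have "(real K + 1) * ln 2 \<le> (real K + 1) * 1" using ln2 by (intro mult_left_mono) auto
  from order_trans[OF lnN(2) this] have "ln N \<le> real K + 1" by simp
  moreover have "ln N \<ge> 2" using lnN(3) ln2(1) by linarith
  ultimately have "ln N / 2 \<le> real K" by simp
  with upper K that show ?thesis by blast
qed

lemma card_odd_primes_less_ge:
  fixes N :: nat
  assumes N: "N \<ge> 3" "24 * ln N \<le> N"
  shows "real N / (12 * ln N) \<le> real (card {p. prime p \<and> odd p \<and> p < N})"
proof -
  let ?A = "{p. prime p \<and> odd p \<and> p < N}"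
  have "ln N > 0" using N by simp
  have "odd p" if "prime p" "p \<noteq> 2" for p :: nat
    using that primes_dvd_imp_eq[of 2 p] by auto
  then have "primes_le (real N) \<subseteq> ?A \<union> {2, N}" by (auto simp: primes_le_def)
  then have "card (primes_le (real N)) \<le> card (?A \<union> {2, N})" by (intro card_mono) auto
  also have "\<dots> \<le> card ?A + card {2, N}" by (rule card_Un_le)
  also have "card {2, N} \<le> 2" by (simp add: card_insert_if)
  finally have "real N / (6 * ln N) \<le> real (card ?A) + 2" using card_primes_le_ge[of N] N by simp
  moreover have "2 \<le> real N / (12 * ln N)" using N(2) \<open>ln N > 0\<close> by (simp add: field_simps)
  moreover have "real N / (6 * ln N) = real N / (12 * ln N) + real N / (12 * ln N)" by simp
  ultimately show ?thesis by linarith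
qed

lemma card_romanoff_numbers_ge:
  fixes N :: nat and C :: real
  assumes N: "N \<ge> 8" "24 * ln N \<le> N"
    and C: "C > 0" "\<And>K. (\<Sum>j=1..K. totient_ratio (mersenne j)) \<le> C * real K"
  shows "real N / (576 * (24 + 4608 * C)) \<le> real (card {n \<in> romanoff_numbers. n \<le> 2 * N})"
proof -
  obtain K where K: "2 ^ K \<le> N" "ln N / 2 \<le> real K" "real K \<le> 2 * ln N"
    using power_2_bracket[OF N(1)] by blast
  define A where "A = {p. prime p \<and> odd p \<and> p < N}"
  let ?f = "\<lambda>(p, k). p + 2 ^ k :: nat" and ?X = "A \<times> {1..K}" and ?R = "{n \<in> romanoff_numbers. n \<le> 2 * N}"
  let ?E = "{(x, y). x \<in> ?X \<and> y \<in> ?X \<and> ?f x = ?f y}"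
  have "finite A" unfolding A_def by (rule finite_subset[of _ "{..N}"]) auto
  have "real N / 24 = real N / (12 * ln N) * (ln N / 2)" using N(1) by simp
  also have "\<dots> \<le> real (card A) * real K"
    unfolding A_def using K N by (intro mult_mono card_odd_primes_less_ge) auto
  finally have "(real N / 24)\<^sup>2 \<le> (real (card ?X))\<^sup>2"
    by (intro power_mono) (auto simp: card_cartesian_product)
  also have "\<dots> \<le> real (card ?E) * real (card (?f ` ?X))"
    using \<open>finite A\<close> by (intro card_squared_le_card_collisions) auto
  also have "\<dots> \<le> (24 + 4608 * C) * real N * real (card ?R)"
  proof (intro mult_mono of_nat_mono card_mono)
    have "real (card ?E) \<le> real (\<Sum>k=1..K. \<Sum>l=1..K. card (prime_collisions N k l))"
      using \<open>finite A\<close> by (intro of_nat_mono card_collisions_le_sum_prime_collisions) (auto simp: A_def)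
    also have "\<dots> \<le> (24 + 4608 * C) * real N"
      using sum_card_prime_collisions_le[OF _ K(3) C(2)] N(1) by simp
    finally show "real (card ?E) \<le> (24 + 4608 * C) * real N" .
    show "?f ` ?X \<subseteq> ?R"
    proof safe
      fix p k assume p: "p \<in> A" and k: "k \<in> {1..K}"
      have "(2::nat) ^ k \<le> 2 ^ K" "p < N" using k p by (auto simp: A_def)
      then show "p + 2 ^ k \<le> 2 * N" using K(1) by linarith
      have "odd (p + 2 ^ k)" using p k by (simp add: A_def)
      then show "p + 2 ^ k \<in> romanoff_numbers" using p k by (auto simp: romanoff_numbers_def A_def)
    qed
  qed (use C(1) in auto)
  finally have "real N * (real N / 576) \<le> real N * ((24 + 4608 * C) * real (card ?R))"
    by (simp add: power2_eq_square mult_ac)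
  then have "real N / 576 \<le> (24 + 4608 * C) * real (card ?R)"
    using N(1) by (subst (asm) mult_le_cancel_left_pos) auto
  then show ?thesis using C(1) by (simp add: field_simps)
qed

theorem romanoff:
  "\<exists>c>0. \<forall>\<^sub>F x in sequentially. c * real x \<le> real (card {n \<in> romanoff_numbers. n \<le> x})"
proof -
  obtain C where C: "C > 0" "\<And>K. (\<Sum>j=1..K. totient_ratio (mersenne j)) \<le> C * real K"
    using sum_totient_ratio_mersenne_le by blast
  define B where "B = 576 * (24 + 4608 * C)"
  have "B > 0" using C(1) by (simp add: B_def)
  have "\<forall>\<^sub>F N in sequentially. 24 * ln (real N) \<le> real N" by real_asymp
  then have "\<forall>\<^sub>F N in sequentially. real N / B \<le> real (card {n \<in> romanoff_numbers. n \<le> 2 * N})"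
    using eventually_ge_at_top[of 8]
    by eventually_elim (simp only: B_def card_romanoff_numbers_ge[OF _ _ C])
  then have "\<forall>\<^sub>F x in sequentially.
      real (x div 2) / B \<le> real (card {n \<in> romanoff_numbers. n \<le> 2 * (x div 2)})"
    by (rule eventually_compose_filterlim) (simp add: filterlim_at_top_div_const_nat)
  then have "\<forall>\<^sub>F x in sequentially. 1 / (4 * B) * real x \<le> real (card {n \<in> romanoff_numbers. n \<le> x})"
    using eventually_ge_at_top[of 2]
  proof eventually_elim
    case (elim x)
    then have "real x / 4 \<le> real (x div 2)" by linarith
    then have "1 / (4 * B) * real x \<le> real (x div 2) / B" using \<open>B > 0\<close> by (simp add: field_simps)
    also note elim(1)
    also have "card {n \<in> romanoff_numbers. n \<le> 2 * (x div 2)} \<le> card {n \<in> romanoff_numbers. n \<le> x}"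
      by (intro card_mono) auto
    finally show ?case by simp
  qed
  moreover have "1 / (4 * B) > 0" using \<open>B > 0\<close> by simp
  ultimately show ?thesis by blast
qed

section \<open>Nearly covering the exponents\<close>

lemma one_minus_inverse_eq:
  assumes "prime (q :: nat)"
  shows "1 - 1 / real q = 1 / (1 + 1 / (real q - 1))"
  using prime_gt_1_nat[OF assms] by (simp add: field_simps)

lemma prod_one_minus_inverse_primes_le:
  assumes "z > 1"
  shows "(\<Prod>q\<in>primes_le z. 1 - 1 / real q) \<le> 1 / ln z"
proof -
  have "ln z \<le> truncated_euler_product (\<lambda>q. 1 / (real q - 1)) (primes_le z) z"
    using assms finite_primes_le by (intro ln_le_truncated_euler_product) (auto simp: primes_le_def)
  also have "\<dots> \<le> (\<Prod>q\<in>primes_le z. 1 + 1 / (real q - 1))"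
    using prime_gt_1_nat[OF primes_leD]
    by (intro truncated_euler_product_le_prod finite_primes_le) force
  finally have "1 / (\<Prod>q\<in>primes_le z. 1 + 1 / (real q - 1)) \<le> 1 / ln z"
    using assms by (intro divide_left_mono mult_pos_pos) (auto intro: less_le_trans[OF ln_gt_zero])
  moreover have "(\<Prod>q\<in>primes_le z. 1 - 1 / real q) = (\<Prod>q\<in>primes_le z. 1 / (1 + 1 / (real q - 1)))"
    by (intro prod.cong refl one_minus_inverse_eq primes_leD)
  ultimately show ?thesis by (simp add: prod_dividef)
qed

lemma tendsto_prod_one_minus_inverse_primes:
  "((\<lambda>z. \<Prod>q\<in>primes_le z. 1 - 1 / real q) \<longlongrightarrow> 0) at_top"
proof (rule tendsto_sandwich[of "\<lambda>_. 0" _ _ "\<lambda>z. 1 / ln z"])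
  show "((\<lambda>z. 1 / ln z) \<longlongrightarrow> (0 :: real)) at_top" by real_asymp
  show "\<forall>\<^sub>F z in at_top. (\<Prod>q\<in>primes_le z. 1 - 1 / real q) \<le> 1 / ln z"
    using eventually_gt_at_top[of 1] by eventually_elim (rule prod_one_minus_inverse_primes_le)
  show "\<forall>\<^sub>F z in at_top. 0 \<le> (\<Prod>q\<in>primes_le z. 1 - 1 / real q)"
    using prime_gt_0_nat[OF primes_leD] by (intro always_eventually allI prod_nonneg) (force simp: Suc_le_eq)
qed simp

lemma prod_one_minus_inverse_primes_small:
  fixes \<epsilon> :: real and n :: nat
  assumes "\<epsilon> > 0"
  shows "\<exists>\<Lambda>. finite \<Lambda> \<and> (\<forall>l\<in>\<Lambda>. prime l \<and> l > n) \<and> (\<Prod>l\<in>\<Lambda>. 1 - 1 / real l) < \<epsilon>"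
proof -
  let ?f = "\<lambda>q::nat. 1 - 1 / real q" and ?R = "primes_le (real n)"
  have f_pos: "?f q > 0" if "prime q" for q using prime_gt_1_nat[OF that] by simp
  have R_pos: "prod ?f ?R > 0" by (intro prod_pos f_pos primes_leD)
  then have "\<forall>\<^sub>F z in at_top. prod ?f (primes_le z) < \<epsilon> * prod ?f ?R"
    using assms by (intro order_tendstoD(2)[OF tendsto_prod_one_minus_inverse_primes]) auto
  then have "\<forall>\<^sub>F z in at_top. prod ?f (primes_le z) < \<epsilon> * prod ?f ?R \<and> z \<ge> real n"
    using eventually_ge_at_top[of "real n"] by (rule eventually_conj)
  then obtain z where z: "prod ?f (primes_le z) < \<epsilon> * prod ?f ?R" "z \<ge> real n"
    using eventually_happens'[OF trivial_limit_at_top_linorder] by blast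
  have "prod ?f (primes_le z - ?R) = prod ?f (primes_le z) / prod ?f ?R"
    using z(2) f_pos by (intro prod_diff finite_primes_le) (force simp: primes_le_def)+
  then have "prod ?f (primes_le z - ?R) < \<epsilon>" using z(1) R_pos by (simp add: divide_less_eq)
  moreover have "\<forall>l\<in>primes_le z - ?R. prime l \<and> l > n" by (auto simp: primes_le_def)
  ultimately show ?thesis
    by (intro exI[of _ "primes_le z - ?R"] conjI finite_Diff finite_primes_le)
qed

lemma prod_covering_factor_small:
  fixes \<epsilon> :: real and n :: nat
  assumes "\<epsilon> > 0"
  shows "\<exists>\<Lambda>. finite \<Lambda> \<and> (\<forall>l\<in>\<Lambda>. prime l \<and> l > n) \<and>
    (\<Prod>l\<in>\<Lambda>. 1 + 1 / (2 * real l)) * (\<Prod>l\<in>\<Lambda>. 1 - 1 / real l) < \<epsilon>"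
proof -
  obtain \<Lambda> where \<Lambda>: "finite \<Lambda>" "\<forall>l\<in>\<Lambda>. prime l \<and> l > n" "(\<Prod>l\<in>\<Lambda>. 1 - 1 / real l) < \<epsilon>\<^sup>2"
    using prod_one_minus_inverse_primes_small[of "\<epsilon>\<^sup>2" n] assms by auto
  let ?p = "(\<Prod>l\<in>\<Lambda>. 1 + 1 / (2 * real l)) * (\<Prod>l\<in>\<Lambda>. 1 - 1 / real l)"
  have factor: "((1 + u / 2) * (1 - u))\<^sup>2 \<le> 1 - u" if "0 \<le> u" "u \<le> 1" for u :: real
  proof -
    have "((1 + u / 2) * (1 - u))\<^sup>2 = (1 - u) * (1 - (3 * u\<^sup>2 / 4 + u ^ 3 / 4))"
      by (simp add: power2_eq_square power3_eq_cube field_simps)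
    also have "\<dots> \<le> (1 - u) * 1"
    proof (intro mult_left_mono)
      have "0 \<le> 3 * u\<^sup>2 / 4 + u ^ 3 / 4" using that(1) by simp
      then show "1 - (3 * u\<^sup>2 / 4 + u ^ 3 / 4) \<le> 1" by linarith
    qed (use that in simp)
    finally show ?thesis by simp
  qed
  have "?p\<^sup>2 = (\<Prod>l\<in>\<Lambda>. ((1 + 1 / (2 * real l)) * (1 - 1 / real l))\<^sup>2)"
    by (simp only: prod.distrib[symmetric] prod_power_distrib)
  also have "\<dots> \<le> (\<Prod>l\<in>\<Lambda>. 1 - 1 / real l)"
  proof (intro prod_mono conjI)
    fix l assume "l \<in> \<Lambda>"
    then have "l > 1" using \<Lambda>(2) prime_gt_1_nat by blast
    then show "((1 + 1 / (2 * real l)) * (1 - 1 / real l))\<^sup>2 \<le> 1 - 1 / real l"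
      using factor[of "1 / real l"] by (simp add: mult.commute)
  qed simp
  finally have "?p\<^sup>2 < \<epsilon>\<^sup>2" using \<Lambda>(3) by linarith
  then have "?p < \<epsilon>" using assms by (intro power_less_imp_less_base[of ?p 2 \<epsilon>]) auto
  then show ?thesis using \<Lambda> by blast
qed

definition uncovered_exponents :: "nat set \<Rightarrow> (nat \<Rightarrow> nat) \<Rightarrow> nat set" where
  "uncovered_exponents \<Lambda> r = {k. \<forall>l\<in>\<Lambda>. k mod l \<noteq> r l}"

lemma popular_residue:
  fixes B :: "nat set" and l :: nat
  assumes B: "finite B" and l: "l > 0"
  shows "\<exists>r. real (card {k \<in> B. k mod l \<noteq> r}) \<le> (1 - 1 / real l) * real (card B)"
proof -
  obtain r where "card B \<le> card ((\<lambda>k. k mod l) -` {r} \<inter> B) * card {..<l}"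
    using pigeonhole_card[of "\<lambda>k. k mod l" B "{..<l}"] B l by auto
  moreover have "(\<lambda>k. k mod l) -` {r} \<inter> B = {k \<in> B. k mod l = r}" by auto
  ultimately have "card B \<le> card {k \<in> B. k mod l = r} * l" by simp
  then have "real (card B) \<le> real (card {k \<in> B. k mod l = r}) * real l"
    by (simp only: of_nat_le_iff flip: of_nat_mult)
  then have "real (card B) / real l \<le> real (card {k \<in> B. k mod l = r})" using l by (simp add: divide_le_eq)
  moreover have "card B = card {k \<in> B. k mod l = r} + card {k \<in> B. k mod l \<noteq> r}"
    using B by (subst card_Un_disjoint[symmetric]) (auto intro!: arg_cong[where f = card])
  ultimately have "real (card {k \<in> B. k mod l \<noteq> r}) \<le> real (card B) - real (card B) / real l"
    by linarith
  then show ?thesis by (intro exI[of _ r]) (simp add: left_diff_distrib)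
qed

lemma card_uncovered_exponents_greedy:
  fixes \<Lambda> B :: "nat set"
  assumes "finite \<Lambda>" "\<And>l. l \<in> \<Lambda> \<Longrightarrow> l > 0" "finite B"
  shows "\<exists>r. real (card (B \<inter> uncovered_exponents \<Lambda> r)) \<le> (\<Prod>l\<in>\<Lambda>. 1 - 1 / real l) * real (card B)"
  using assms
proof (induction \<Lambda> rule: finite_induct)
  case (insert x F)
  then obtain r where r: "real (card (B \<inter> uncovered_exponents F r)) \<le> (\<Prod>l\<in>F. 1 - 1 / real l) * real (card B)"
    by auto
  obtain s where s: "real (card {k \<in> B \<inter> uncovered_exponents F r. k mod x \<noteq> s})
      \<le> (1 - 1 / real x) * real (card (B \<inter> uncovered_exponents F r))"
    using popular_residue[of "B \<inter> uncovered_exponents F r" x] insert by auto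
  have "B \<inter> uncovered_exponents (insert x F) (r(x := s)) = {k \<in> B \<inter> uncovered_exponents F r. k mod x \<noteq> s}"
    using insert(2) by (auto simp: uncovered_exponents_def)
  then have "real (card (B \<inter> uncovered_exponents (insert x F) (r(x := s))))
      \<le> (1 - 1 / real x) * real (card (B \<inter> uncovered_exponents F r))"
    using s by (simp only:)
  also have "\<dots> \<le> (1 - 1 / real x) * ((\<Prod>l\<in>F. 1 - 1 / real l) * real (card B))"
    using r insert.prems(1)[of x] by (intro mult_left_mono) auto
  also have "\<dots> = (\<Prod>l\<in>insert x F. 1 - 1 / real l) * real (card B)" using insert by simp
  finally show ?case by blast
qed (simp add: uncovered_exponents_def)

lemma card_uncovered_exponents_less_le:
  fixes \<Lambda> :: "nat set"
  assumes \<Lambda>: "finite \<Lambda>" "\<And>l. l \<in> \<Lambda> \<Longrightarrow> l > 0"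
  shows "\<exists>r L. \<forall>K. real (card ({..<K} \<inter> uncovered_exponents \<Lambda> r)) \<le> (\<Prod>l\<in>\<Lambda>. 1 - 1 / real l) * real K + L"
proof -
  define d where "d = \<Prod>\<Lambda>"
  let ?\<delta> = "\<Prod>l\<in>\<Lambda>. 1 - 1 / real l"
  have "d > 0" unfolding d_def using \<Lambda> by (intro prod_pos) auto
  obtain r where r: "real (card ({..<d} \<inter> uncovered_exponents \<Lambda> r)) \<le> ?\<delta> * real d"
    using card_uncovered_exponents_greedy[OF \<Lambda>, of "{..<d}"] by auto
  define V where "V = {..<d} \<inter> uncovered_exponents \<Lambda> r"
  have mod_mod: "k mod d mod l = k mod l" if "l \<in> \<Lambda>" for k l
    unfolding d_def using dvd_prodI[OF \<Lambda>(1) that, of "\<lambda>x. x"] by (simp add: mod_mod_cancel)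
  have "real (card ({..<K} \<inter> uncovered_exponents \<Lambda> r)) \<le> ?\<delta> * real K + real (card V)" for K
  proof -
    have "{..<K} \<inter> uncovered_exponents \<Lambda> r = {k. k < K \<and> k mod d \<in> V}"
      using mod_mod \<open>d > 0\<close> by (auto simp: V_def uncovered_exponents_def)
    then have "real (card ({..<K} \<inter> uncovered_exponents \<Lambda> r))
        \<le> real (card V) * (real K / real d) + real (card V)"
      using card_residue_classes_less[of V d K] by (simp add: V_def)
    also have "real (card V) * (real K / real d) \<le> ?\<delta> * real d * (real K / real d)"
      using r unfolding V_def by (intro mult_right_mono) auto
    also have "\<dots> = ?\<delta> * real K" using \<open>d > 0\<close> by simp
    finally show ?thesis by simp
  qed
  then show ?thesis by blast
qed

section \<open>Progressions with few Romanoff numbers\<close>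

lemma exists_prime_with_order:
  fixes l :: nat
  assumes l: "prime l" "l > 2"
  shows "\<exists>q. prime q \<and> ord q 2 = l \<and> 2 * l + 1 \<le> q"
proof -
  have "(2::nat) ^ 2 \<le> 2 ^ l" using l by (intro power_increasing) auto
  then have "mersenne l \<noteq> 1" by (simp add: mersenne_def)
  then obtain q :: nat where q: "prime q" "q dvd mersenne l" using prime_factor_nat by blast
  have "ord q 2 dvd l" using q(2) by (simp only: dvd_mersenne_iff_ord_dvd)
  then have "ord q 2 = 1 \<or> ord q 2 = l" using l(1) by (simp add: prime_nat_iff)
  moreover have "\<not> q dvd mersenne 1" using prime_gt_1_nat[OF q(1)] by (simp add: mersenne_def)
  then have "ord q 2 \<noteq> 1" by (metis dvd_mersenne_iff_ord_dvd dvd_refl)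
  ultimately have ord: "ord q 2 = l" by blast
  have "odd (mersenne l)" using l by (simp add: mersenne_def)
  then have "odd q" using q(2) by (metis dvd_trans)
  then have "\<not> q dvd 2" using q(1) primes_dvd_imp_eq[of q 2] by auto
  then have "[2 ^ (q - 1) = 1] (mod q)" using fermat_theorem[OF q(1)] by blast
  then have "l dvd q - 1" using ord by (simp only: ord_divides)
  moreover have "2 dvd q - 1" using \<open>odd q\<close> by simp
  moreover have "coprime 2 l" using l primes_coprime[of 2 l] by auto
  ultimately have "2 * l dvd q - 1" by (simp add: divides_mult)
  then have "2 * l \<le> q - 1" using prime_gt_1_nat[OF q(1)] by (intro dvd_imp_le) auto
  then have "2 * l + 1 \<le> q" using prime_gt_1_nat[OF q(1)] by simp
  with q ord show ?thesis by blast
qed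

lemma prime_eq_if_shift_covered:
  fixes b k p q r :: nat
  assumes q: "prime q" and r: "k mod ord q 2 = r" "[b = 2 ^ r] (mod q)"
    and p: "prime p" "[p + 2 ^ k = b] (mod q)"
  shows "p = q"
proof -
  let ?l = "ord q 2"
  have "(2::nat) ^ k = (2 ^ ?l) ^ (k div ?l) * 2 ^ r"
    unfolding r(1)[symmetric] by (simp flip: power_mult power_add)
  also have "[(2 ^ ?l) ^ (k div ?l) * 2 ^ r = 1 ^ (k div ?l) * 2 ^ r] (mod q)"
    by (intro cong_mult cong_pow ord cong_refl)
  finally have "[0 + 2 ^ k = b] (mod q)" using r(2) cong_sym cong_trans by (metis add_0 mult_1 power_one)
  then have "[p + 2 ^ k = 0 + 2 ^ k] (mod q)" using p(2) cong_sym cong_trans by blast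
  then have "q dvd p" by (simp only: cong_add_rcancel_nat cong_0_iff)
  then show ?thesis using p(1) q primes_dvd_imp_eq by metis
qed

lemma totient_ratio_mult_prod_le:
  fixes q :: "'a \<Rightarrow> nat"
  assumes "finite \<Lambda>"
  shows "totient_ratio (m * (\<Prod>l\<in>\<Lambda>. q l)) \<le> totient_ratio m * (\<Prod>l\<in>\<Lambda>. totient_ratio (q l))"
  using assms
proof (induction \<Lambda> rule: finite_induct)
  case (insert x F)
  have "totient_ratio (m * (\<Prod>l\<in>insert x F. q l)) = totient_ratio (q x * (m * (\<Prod>l\<in>F. q l)))"
    using insert.hyps by (simp add: mult_ac)
  also have "\<dots> \<le> totient_ratio (q x) * totient_ratio (m * (\<Prod>l\<in>F. q l))"
    by (rule totient_ratio_mult_le)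
  also have "\<dots> \<le> totient_ratio (q x) * (totient_ratio m * (\<Prod>l\<in>F. totient_ratio (q l)))"
    by (intro mult_left_mono insert.IH totient_ratio_nonneg)
  finally show ?case using insert.hyps by (simp add: mult_ac)
qed simp

lemma totient_ratio_mult_prod_primes_le:
  fixes q :: "nat \<Rightarrow> nat"
  assumes "finite \<Lambda>" and q: "\<And>l. l \<in> \<Lambda> \<Longrightarrow> prime (q l)" "\<And>l. l \<in> \<Lambda> \<Longrightarrow> 0 < l \<and> 2 * l + 1 \<le> q l"
  shows "totient_ratio (m * (\<Prod>l\<in>\<Lambda>. q l)) \<le> totient_ratio m * (\<Prod>l\<in>\<Lambda>. 1 + 1 / (2 * real l))"
proof -
  have "totient_ratio (m * (\<Prod>l\<in>\<Lambda>. q l)) \<le> totient_ratio m * (\<Prod>l\<in>\<Lambda>. totient_ratio (q l))"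
    using assms(1) by (rule totient_ratio_mult_prod_le)
  also have "\<dots> \<le> totient_ratio m * (\<Prod>l\<in>\<Lambda>. 1 + 1 / (2 * real l))"
  proof (intro mult_left_mono prod_mono conjI totient_ratio_nonneg)
    fix l assume l: "l \<in> \<Lambda>"
    have "real (2 * l + 1) \<le> real (q l)" using q(2)[OF l] by (simp only: of_nat_le_iff)
    then show "totient_ratio (q l) \<le> 1 + 1 / (2 * real l)"
      unfolding totient_ratio_prime[OF q(1)[OF l]] using q(2)[OF l]
      by (intro add_left_mono divide_left_mono) auto
  qed
  finally show ?thesis .
qed

lemma exists_cong_mod_and_family:
  fixes m a :: nat and q u :: "'a \<Rightarrow> nat"
  assumes "finite \<Lambda>" and m: "\<And>l. l \<in> \<Lambda> \<Longrightarrow> coprime m (q l)"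
    and q: "\<And>i j. i \<in> \<Lambda> \<Longrightarrow> j \<in> \<Lambda> \<Longrightarrow> i \<noteq> j \<Longrightarrow> coprime (q i) (q j)"
  shows "\<exists>b. [b = a] (mod m) \<and> (\<forall>l\<in>\<Lambda>. [b = u l] (mod q l))"
proof -
  obtain c where c: "\<forall>l\<in>\<Lambda>. [c = u l] (mod q l)"
    using chinese_remainder_nat[OF assms(1), of q u] q by blast
  have "coprime m (\<Prod>l\<in>\<Lambda>. q l)" using m by (rule prod_coprime_right)
  then obtain b where b: "[b = a] (mod m)" "[b = c] (mod (\<Prod>l\<in>\<Lambda>. q l))"
    using binary_chinese_remainder_nat by blast
  have "[b = u l] (mod q l)" if "l \<in> \<Lambda>" for l
    using b(2) c that dvd_prodI[OF assms(1) that] cong_dvd_modulus_nat cong_trans by blast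
  with b(1) show ?thesis by blast
qed

lemma exists_covering_progression:
  fixes \<Lambda> :: "nat set" and r :: "nat \<Rightarrow> nat" and m a :: nat
  assumes m: "m > 0" and \<Lambda>: "finite \<Lambda>" "\<And>l. l \<in> \<Lambda> \<Longrightarrow> prime l \<and> l > max m 2"
  shows "\<exists>M b. M > 0 \<and> m dvd M \<and> [b = a] (mod m) \<and>
    totient_ratio M \<le> totient_ratio m * (\<Prod>l\<in>\<Lambda>. 1 + 1 / (2 * real l)) \<and>
    (\<forall>k. k \<notin> uncovered_exponents \<Lambda> r \<longrightarrow> (\<exists>q. \<forall>p. prime p \<and> [p + 2 ^ k = b] (mod M) \<longrightarrow> p = q))"
proof -
  have "\<forall>l\<in>\<Lambda>. \<exists>q. prime q \<and> ord q 2 = l \<and> 2 * l + 1 \<le> q"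
    using \<Lambda>(2) by (intro ballI exists_prime_with_order) auto
  then obtain q where q: "\<And>l. l \<in> \<Lambda> \<Longrightarrow> prime (q l)" "\<And>l. l \<in> \<Lambda> \<Longrightarrow> ord (q l) 2 = l"
    "\<And>l. l \<in> \<Lambda> \<Longrightarrow> 2 * l + 1 \<le> q l"
    by metis
  define M where "M = m * (\<Prod>l\<in>\<Lambda>. q l)"
  have "M > 0" unfolding M_def using m q(1) by (intro mult_pos_pos prod_pos) (auto intro!: prime_gt_0_nat)
  have coprime_m: "coprime m (q l)" if l: "l \<in> \<Lambda>" for l
  proof -
    have "m < q l" using q(3)[OF l] \<Lambda>(2)[OF l] by simp
    then have "\<not> q l dvd m" using m by (auto dest: dvd_imp_le)
    then show ?thesis using prime_imp_coprime[OF q(1)[OF l]] by (simp add: coprime_commute)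
  qed
  have coprime_q: "coprime (q i) (q j)" if "i \<in> \<Lambda>" "j \<in> \<Lambda>" "i \<noteq> j" for i j
    using q(1,2) that by (intro primes_coprime) metis+
  have "\<exists>b. [b = a] (mod m) \<and> (\<forall>l\<in>\<Lambda>. [b = 2 ^ r l] (mod q l))"
    using \<Lambda>(1) coprime_m coprime_q by (rule exists_cong_mod_and_family)
  then obtain b where b: "[b = a] (mod m)" "\<And>l. l \<in> \<Lambda> \<Longrightarrow> [b = 2 ^ r l] (mod q l)" by blast
  have "\<exists>q. \<forall>p. prime p \<and> [p + 2 ^ k = b] (mod M) \<longrightarrow> p = q" if k: "k \<notin> uncovered_exponents \<Lambda> r" for k
  proof -
    obtain l where l: "l \<in> \<Lambda>" "k mod l = r l" using k by (auto simp: uncovered_exponents_def)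
    have "q l dvd M" unfolding M_def using dvd_prodI[OF \<Lambda>(1) l(1)] by (rule dvd_mult)
    then have "p = q l" if "prime p" "[p + 2 ^ k = b] (mod M)" for p
      using that q(1,2)[OF l(1)] l(2) b(2)[OF l(1)] cong_dvd_modulus_nat
      by (intro prime_eq_if_shift_covered[of "q l" k "r l" b p]) auto
    then show ?thesis by blast
  qed
  moreover have "totient_ratio M \<le> totient_ratio m * (\<Prod>l\<in>\<Lambda>. 1 + 1 / (2 * real l))"
    unfolding M_def using \<Lambda> q prime_gt_0_nat by (intro totient_ratio_mult_prod_primes_le) blast+
  moreover have "m dvd M" by (simp add: M_def)
  ultimately show ?thesis using \<open>M > 0\<close> b(1) by blast
qed

definition primes_shifted_cong :: "nat \<Rightarrow> nat \<Rightarrow> nat \<Rightarrow> nat \<Rightarrow> nat set" where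
  "primes_shifted_cong M b x k = {p. prime p \<and> p \<le> x \<and> [p + 2 ^ k = b] (mod M)}"

lemma finite_primes_shifted_cong: "finite (primes_shifted_cong M b x k)"
  by (rule finite_subset[of _ "{..x}"]) (auto simp: primes_shifted_cong_def)

lemma card_primes_shifted_cong_le:
  assumes M: "M > 0" and x: "x \<ge> 2" "x \<ge> M ^ 2"
  shows "real (card (primes_shifted_cong M b x k)) \<le> 48 * totient_ratio M * real x / (real M * ln x)"
proof (cases "primes_shifted_cong M b x k = {}")
  case True
  then show ?thesis using totient_ratio_nonneg[of M] x by simp
next
  case False
  then obtain p0 where p0: "[p0 + 2 ^ k = b] (mod M)" by (auto simp: primes_shifted_cong_def)
  have "primes_shifted_cong M b x k \<subseteq> {p. prime p \<and> p \<le> x \<and> [p = p0] (mod M)}"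
  proof
    fix p assume p: "p \<in> primes_shifted_cong M b x k"
    then have "[p + 2 ^ k = b] (mod M)" by (simp add: primes_shifted_cong_def)
    then have "[p + 2 ^ k = p0 + 2 ^ k] (mod M)" using p0 cong_sym cong_trans by blast
    then show "p \<in> {p. prime p \<and> p \<le> x \<and> [p = p0] (mod M)}"
      using p by (simp add: primes_shifted_cong_def cong_add_rcancel_nat)
  qed
  then have "card (primes_shifted_cong M b x k) \<le> card {p. prime p \<and> p \<le> x \<and> [p = p0] (mod M)}"
    by (intro card_mono) (auto intro: finite_subset[of _ "{..x}"])
  then show ?thesis using card_primes_cong_le[OF assms, of p0] by linarith
qed

lemma card_romanoff_numbers_cong_le_sum:
  assumes "x < 2 ^ K"
  shows "card {n \<in> romanoff_numbers. n \<le> x \<and> [n = b] (mod M)} \<le> (\<Sum>k<K. card (primes_shifted_cong M b x k))"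
proof -
  have "{n \<in> romanoff_numbers. n \<le> x \<and> [n = b] (mod M)}
      \<subseteq> (\<Union>k\<in>{..<K}. (\<lambda>p. p + 2 ^ k) ` primes_shifted_cong M b x k)"
  proof
    fix n assume "n \<in> {n \<in> romanoff_numbers. n \<le> x \<and> [n = b] (mod M)}"
    then obtain p k where n: "n \<le> x" "[n = b] (mod M)" "prime p" "n = p + 2 ^ k"
      by (auto simp: romanoff_numbers_def)
    have "(2::nat) ^ k < 2 ^ K" using n(1,4) assms by linarith
    then have "k < K" by (rule power_less_imp_less_exp[rotated]) simp
    then show "n \<in> (\<Union>k\<in>{..<K}. (\<lambda>p. p + 2 ^ k) ` primes_shifted_cong M b x k)"
      using n by (intro UN_I[of k] image_eqI[of _ _ p]) (auto simp: primes_shifted_cong_def)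
  qed
  then have "card {n \<in> romanoff_numbers. n \<le> x \<and> [n = b] (mod M)}
      \<le> card (\<Union>k\<in>{..<K}. (\<lambda>p. p + 2 ^ k) ` primes_shifted_cong M b x k)"
    by (intro card_mono) (auto simp: finite_primes_shifted_cong)
  also have "\<dots> \<le> (\<Sum>k<K. card ((\<lambda>p. p + 2 ^ k) ` primes_shifted_cong M b x k))"
    by (intro card_UN_le) auto
  also have "\<dots> \<le> (\<Sum>k<K. card (primes_shifted_cong M b x k))"
    by (intro sum_mono card_image_le finite_primes_shifted_cong)
  finally show ?thesis .
qed

lemma card_romanoff_numbers_cong_le:
  fixes \<delta> L :: real
  assumes M: "M > 0" and x: "x \<ge> 8" "x \<ge> M ^ 2" and "\<delta> \<ge> 0"
    and uncovered: "\<And>K. real (card ({..<K} \<inter> U)) \<le> \<delta> * real K + L"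
    and covered: "\<And>k. k \<notin> U \<Longrightarrow> \<exists>q. \<forall>p. prime p \<and> [p + 2 ^ k = b] (mod M) \<longrightarrow> p = q"
  shows "real (card {n \<in> romanoff_numbers. n \<le> x \<and> [n = b] (mod M)})
    \<le> 3 * ln x + (3 * \<delta> * ln x + L) * (48 * totient_ratio M * real x / (real M * ln x))"
proof -
  let ?R = "primes_shifted_cong M b x" and ?Y = "48 * totient_ratio M * real x / (real M * ln x)"
  obtain K where K: "x < 2 ^ (K + 1)" "real K \<le> 2 * ln x" using power_2_bracket[OF x(1)] by blast
  have "ln 4 \<le> ln (real x)" using x(1) by simp
  then have "1 \<le> ln x" using ln_4_ge_1 by linarith
  with K(2) have K_le: "real (K + 1) \<le> 3 * ln x" by simp
  have "?Y \<ge> 0" using totient_ratio_nonneg[of M] \<open>1 \<le> ln x\<close> by simp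
  have "real (card {n \<in> romanoff_numbers. n \<le> x \<and> [n = b] (mod M)}) \<le> real (\<Sum>k<K + 1. card (?R k))"
    using card_romanoff_numbers_cong_le_sum[OF K(1)] by (simp only: of_nat_le_iff)
  also have "\<dots> = (\<Sum>k<K + 1. real (card (?R k)))" by (rule of_nat_sum)
  also have "\<dots> \<le> (\<Sum>k<K + 1. 1 + (if k \<in> U then ?Y else 0))"
  proof (intro sum_mono)
    fix k
    show "real (card (?R k)) \<le> 1 + (if k \<in> U then ?Y else 0)"
    proof (cases "k \<in> U")
      case True
      have "real (card (?R k)) \<le> ?Y" using M x by (intro card_primes_shifted_cong_le) auto
      then show ?thesis using True by simp
    next
      case False
      then obtain q where "\<forall>p. prime p \<and> [p + 2 ^ k = b] (mod M) \<longrightarrow> p = q" using covered by blast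
      then have "?R k \<subseteq> {q}" by (auto simp: primes_shifted_cong_def)
      then have "card (?R k) \<le> card {q}" by (intro card_mono) auto
      then show ?thesis using False by simp
    qed
  qed
  also have "\<dots> = real (K + 1) + real (card ({..<K + 1} \<inter> U)) * ?Y"
    by (simp only: sum.distrib sum.If_cases finite_lessThan Collect_mem_eq) simp
  also have "\<dots> \<le> 3 * ln x + (3 * \<delta> * ln x + L) * ?Y"
  proof (intro add_mono mult_right_mono K_le \<open>?Y \<ge> 0\<close>)
    have "\<delta> * real (K + 1) \<le> \<delta> * (3 * ln x)" using K_le \<open>\<delta> \<ge> 0\<close> by (rule mult_left_mono)
    then show "real (card ({..<K + 1} \<inter> U)) \<le> 3 * \<delta> * ln x + L" using uncovered[of "K + 1"] by simp
  qed
  finally show ?thesis .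
qed

lemma eventually_error_terms_small:
  fixes A B c :: real
  assumes "c > 0"
  shows "\<forall>\<^sub>F x in sequentially. A * ln (real x) + B * real x / ln (real x) \<le> c * real x"
proof -
  have "(\<lambda>x::nat. ln (real x) / real x) \<longlonglongrightarrow> 0" "(\<lambda>x::nat. 1 / ln (real x)) \<longlonglongrightarrow> 0" by real_asymp+
  then have "(\<lambda>x::nat. A * (ln (real x) / real x) + B * (1 / ln (real x))) \<longlonglongrightarrow> A * 0 + B * 0"
    by (intro tendsto_intros)
  then have "\<forall>\<^sub>F x in sequentially. A * (ln (real x) / real x) + B * (1 / ln (real x)) < c"
    using assms by (intro order_tendstoD) auto
  then show ?thesis using eventually_gt_at_top[of 0]
  proof eventually_elim
    case (elim x)
    have "(A * (ln (real x) / real x) + B * (1 / ln (real x))) * real x \<le> c * real x"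
      using elim by (intro mult_right_mono) auto
    then show ?case using elim by (simp add: distrib_right)
  qed
qed

text \<open>Fixing the residues of \<open>b\<close> modulo primes \<open>q l\<close> with \<open>ord (q l) 2 = l\<close>, for many primes \<open>l\<close>, forces
  \<open>q l\<close> to divide \<open>b - 2 ^ k\<close> for all \<open>k\<close> outside a set of density \<open>\<Prod>(1 - 1 / l)\<close>. Since
  \<open>q l > 2 * l\<close>, the factor \<open>\<Prod>(1 + 1 / (2 * l))\<close> lost in the Brun-Titchmarsh bound is smaller than
  what is gained.\<close>

lemma exists_nearly_covered_progression:
  fixes m a :: nat and \<epsilon> :: real
  assumes m: "m > 0" and \<epsilon>: "\<epsilon> > 0"
  shows "\<exists>M b U \<delta> L. M > 0 \<and> m dvd M \<and> [b = a] (mod m) \<and> \<delta> \<ge> 0 \<and> totient_ratio M * \<delta> \<le> \<epsilon> \<and>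
    (\<forall>K. real (card ({..<K} \<inter> U)) \<le> \<delta> * real K + L) \<and>
    (\<forall>k. k \<notin> U \<longrightarrow> (\<exists>q. \<forall>p. prime p \<and> [p + 2 ^ k = b] (mod M) \<longrightarrow> p = q))"
proof -
  have totient_ratio_m_ge_1: "totient_ratio m \<ge> 1" using m by (rule totient_ratio_ge_1)
  then have "\<epsilon> / totient_ratio m > 0" using \<epsilon> by simp
  then obtain \<Lambda> where \<Lambda>: "finite \<Lambda>" "\<And>l. l \<in> \<Lambda> \<Longrightarrow> prime l \<and> l > max m 2"
    and small: "(\<Prod>l\<in>\<Lambda>. 1 + 1 / (2 * real l)) * (\<Prod>l\<in>\<Lambda>. 1 - 1 / real l) < \<epsilon> / totient_ratio m"
    using prod_covering_factor_small[of "\<epsilon> / totient_ratio m" "max m 2"] by auto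
  define \<delta> where "\<delta> = (\<Prod>l\<in>\<Lambda>. 1 - 1 / real l)"
  have "\<delta> \<ge> 0" unfolding \<delta>_def using \<Lambda>(2) by (intro prod_nonneg) (force simp: Suc_le_eq)
  obtain r L where uncovered: "\<And>K. real (card ({..<K} \<inter> uncovered_exponents \<Lambda> r)) \<le> \<delta> * real K + L"
    unfolding \<delta>_def using card_uncovered_exponents_less_le[OF \<Lambda>(1)] \<Lambda>(2) by fastforce
  obtain M b where M: "M > 0" "m dvd M" "[b = a] (mod m)"
    and totient_ratio_M_le: "totient_ratio M \<le> totient_ratio m * (\<Prod>l\<in>\<Lambda>. 1 + 1 / (2 * real l))"
    and covered: "\<And>k. k \<notin> uncovered_exponents \<Lambda> r \<Longrightarrow>
      \<exists>q. \<forall>p. prime p \<and> [p + 2 ^ k = b] (mod M) \<longrightarrow> p = q"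
    using exists_covering_progression[OF m \<Lambda>] by metis
  have "totient_ratio M * \<delta> \<le> totient_ratio m * ((\<Prod>l\<in>\<Lambda>. 1 + 1 / (2 * real l)) * \<delta>)"
    using mult_right_mono[OF totient_ratio_M_le \<open>\<delta> \<ge> 0\<close>] by (simp add: mult.assoc)
  also have "\<dots> \<le> totient_ratio m * (\<epsilon> / totient_ratio m)"
    using small totient_ratio_m_ge_1 unfolding \<delta>_def by (intro mult_left_mono) auto
  finally have "totient_ratio M * \<delta> \<le> \<epsilon>" using totient_ratio_m_ge_1 by simp
  then show ?thesis using M \<open>\<delta> \<ge> 0\<close> uncovered covered by blast
qed

theorem exists_sparse_subprogression:
  fixes m a :: nat
  assumes m: "m > 0"
  shows "\<exists>M b. M > 0 \<and> m dvd M \<and> [b = a] (mod m) \<and> (\<forall>\<^sub>F x in sequentially.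
    real (card {n \<in> romanoff_numbers. n \<le> x \<and> [n = b] (mod M)}) \<le> real x / (2 * real M))"
proof -
  obtain M b U \<delta> L where M: "M > 0" "m dvd M" and b: "[b = a] (mod m)"
    and \<delta>: "\<delta> \<ge> 0" "totient_ratio M * \<delta> \<le> 1 / 576"
    and uncovered: "\<And>K. real (card ({..<K} \<inter> U)) \<le> \<delta> * real K + L"
    and covered: "\<And>k. k \<notin> U \<Longrightarrow> \<exists>q. \<forall>p. prime p \<and> [p + 2 ^ k = b] (mod M) \<longrightarrow> p = q"
    using exists_nearly_covered_progression[OF m, of "1 / 576"] by (metis zero_less_divide_1_iff zero_less_numeral)
  define t where "t = totient_ratio M"
  have t\<delta>_small: "144 * (t * \<delta>) \<le> 1 / 4" using \<delta>(2) by (simp add: t_def)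
  have "\<forall>\<^sub>F x in sequentially.
      3 * ln (real x) + (48 * t * L / real M) * real x / ln (real x) \<le> 1 / (4 * real M) * real x"
    using M(1) by (intro eventually_error_terms_small) simp
  then have "\<forall>\<^sub>F x in sequentially.
      real (card {n \<in> romanoff_numbers. n \<le> x \<and> [n = b] (mod M)}) \<le> real x / (2 * real M)"
    using eventually_ge_at_top[of "max 8 (M ^ 2)"]
  proof eventually_elim
    case (elim x)
    then have x: "x \<ge> 8" "x \<ge> M ^ 2" by auto
    then have "ln (real x) > 0" by simp
    have "real (card {n \<in> romanoff_numbers. n \<le> x \<and> [n = b] (mod M)})
        \<le> 3 * ln x + (3 * \<delta> * ln x + L) * (48 * t * real x / (real M * ln x))"
      unfolding t_def using M(1) x \<delta>(1) uncovered covered by (rule card_romanoff_numbers_cong_le)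
    also have "\<dots> = 144 * (t * \<delta>) * (real x / real M) + (3 * ln x + (48 * t * L / real M) * real x / ln x)"
      using \<open>ln (real x) > 0\<close> M(1) by (simp add: field_simps)
    also have "\<dots> \<le> 1 / 4 * (real x / real M) + 1 / (4 * real M) * real x"
      using t\<delta>_small elim(1) by (intro add_mono mult_right_mono) auto
    also have "\<dots> = real x / (2 * real M)" by simp
    finally show ?case .
  qed
  then show ?thesis using M b by blast
qed

section \<open>Sets of density zero\<close>

lemma has_asymp_density_zeroD:
  assumes "has_asymp_density A 0" "c > 0"
  shows "\<forall>\<^sub>F x in sequentially. real (card {n \<in> A. 1 \<le> n \<and> n \<le> x}) \<le> c * real x"
proof -
  have "((\<lambda>x::real. real (card {n \<in> A. 1 \<le> n \<and> real n \<le> x}) / x) \<longlongrightarrow> 0) at_top"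
    using assms(1) by (simp add: has_asymp_density_def)
  from filterlim_compose[OF this filterlim_real_sequentially]
  have "(\<lambda>x::nat. real (card {n \<in> A. 1 \<le> n \<and> n \<le> x}) / real x) \<longlonglongrightarrow> 0" by simp
  then have "\<forall>\<^sub>F x in sequentially. real (card {n \<in> A. 1 \<le> n \<and> n \<le> x}) / real x < c"
    using assms(2) by (intro order_tendstoD)
  then show ?thesis using eventually_gt_at_top[of 0]
    by eventually_elim (simp add: field_simps)
qed

lemma \<U>_eq: "\<U> = {n. odd n} - romanoff_numbers"
  unfolding \<U>_def romanoff_numbers_def by (blast intro: odd_pos)

lemma romanoff_numbers_not_density_zero:
  assumes "has_asymp_density S 0"
  shows "\<exists>n\<ge>n0. n \<in> romanoff_numbers \<and> n \<notin> S"
proof (rule ccontr)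
  assume "\<not> ?thesis"
  then have subset: "n \<in> S" if "n \<ge> n0" "n \<in> romanoff_numbers" for n using that by blast
  obtain c where "c > 0"
    and lower: "\<forall>\<^sub>F x in sequentially. c * real x \<le> real (card {n \<in> romanoff_numbers. n \<le> x})"
    using romanoff by blast
  have "\<forall>\<^sub>F x in sequentially. real (card {n \<in> S. 1 \<le> n \<and> n \<le> x}) \<le> c / 2 * real x"
    using \<open>c > 0\<close> by (intro has_asymp_density_zeroD[OF assms]) simp
  moreover have "\<forall>\<^sub>F x in sequentially. real n0 < c / 2 * real x" using \<open>c > 0\<close> by real_asymp
  ultimately have "\<forall>\<^sub>F x :: nat in sequentially. False" using lower
  proof eventually_elim
    case (elim x)
    have "n \<ge> 1" if "n \<in> romanoff_numbers" for n
      using that by (auto simp: romanoff_numbers_def elim: oddE)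
    then have "{n \<in> romanoff_numbers. n \<le> x} \<subseteq> {..<n0} \<union> {n \<in> S. 1 \<le> n \<and> n \<le> x}"
      using subset by (auto simp: not_less)
    then have "card {n \<in> romanoff_numbers. n \<le> x} \<le> card ({..<n0} \<union> {n \<in> S. 1 \<le> n \<and> n \<le> x})"
      by (intro card_mono) auto
    also have "\<dots> \<le> card {..<n0} + card {n \<in> S. 1 \<le> n \<and> n \<le> x}" by (rule card_Un_le)
    finally show False using elim by simp
  qed
  then show False by simp
qed

lemma odd_progression_meets_\<U>:
  assumes m: "m > 0" "even m" and a: "odd a" and T: "has_asymp_density T 0"
  shows "\<exists>n. [n = a] (mod m) \<and> n \<in> \<U> \<and> n \<notin> T"
proof (rule ccontr)
  assume "\<not> ?thesis"
  then have subset: "n \<in> T" if "[n = a] (mod m)" "n \<in> \<U>" for n using that by blast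
  obtain M b where M: "M > 0" "m dvd M" and b: "[b = a] (mod m)" and sparse: "\<forall>\<^sub>F x in sequentially.
      real (card {n \<in> romanoff_numbers. n \<le> x \<and> [n = b] (mod M)}) \<le> real x / (2 * real M)"
    using exists_sparse_subprogression[OF m(1)] by blast
  have "\<forall>\<^sub>F x in sequentially. real (card {n \<in> T. 1 \<le> n \<and> n \<le> x}) \<le> 1 / (4 * real M) * real x"
    using M by (intro has_asymp_density_zeroD[OF T]) simp
  moreover have "\<forall>\<^sub>F x in sequentially. 1 < 1 / (4 * real M) * real x"
    using M by real_asymp
  ultimately have "\<forall>\<^sub>F x :: nat in sequentially. False" using sparse
  proof eventually_elim
    case (elim x)
    let ?B = "{n. n < x \<and> n mod M = b mod M}" and ?T = "{n \<in> T. 1 \<le> n \<and> n \<le> x}"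
    let ?R = "{n \<in> romanoff_numbers. n \<le> x \<and> [n = b] (mod M)}"
    have "?B \<subseteq> ?T \<union> ?R"
    proof
      fix n assume n: "n \<in> ?B"
      then have cong_b: "[n = b] (mod M)" by (simp add: Cong.cong_def)
      then have cong_a: "[n = a] (mod m)" using M(2) b cong_dvd_modulus_nat cong_trans by blast
      then have "[n = a] (mod 2)" using m(2) cong_dvd_modulus_nat by blast
      then have "odd n" using a by (simp add: Cong.cong_def odd_iff_mod_2_eq_one)
      then show "n \<in> ?T \<union> ?R"
        using n cong_b subset[OF cong_a] by (auto simp: \<U>_eq elim: oddE)
    qed
    then have "card ?B \<le> card (?T \<union> ?R)" by (intro card_mono) auto
    also have "\<dots> \<le> card ?T + card ?R" by (rule card_Un_le)
    finally have "real (card ?B) \<le> 1 / (4 * real M) * real x + real x / (2 * real M)" using elim by simp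
    also have "\<dots> = real x / real M - 1 / (4 * real M) * real x" using M by (simp add: field_simps)
    also have "\<dots> < real x / real M - 1" using elim by simp
    finally have "real (card ?B) < real x / real M - 1" .
    moreover have "\<bar>real (card ?B) - real x / real M\<bar> \<le> 1" using M by (intro card_residue_class_less) simp
    ultimately show False by linarith
  qed
  then show False by simp
qed

section \<open>Finite unions of arithmetic progressions\<close>

lemma mem_arith_prog_iff: "n \<in> arith_prog m a \<longleftrightarrow> a \<le> n \<and> [n = a] (mod m)"
proof
  assume "a \<le> n \<and> [n = a] (mod m)"
  then show "n \<in> arith_prog m a"
    by (auto simp: arith_prog_def cong_le_nat mult.commute)
qed (auto simp: arith_prog_def Cong.cong_def)

lemma mem_arith_prog_if_large:
  assumes "finite P"
  obtains n0 where "\<And>n m a. (m, a) \<in> P \<Longrightarrow> n0 \<le> n \<Longrightarrow> [n = a] (mod m) \<Longrightarrow> n \<in> arith_prog m a"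
proof -
  obtain n0 where "\<forall>a\<in>snd ` P. a \<le> n0"
    using assms finite_nat_set_iff_bounded_le by blast
  then have "a \<le> n0" if "(m, a) \<in> P" for m a using that by force
  then show thesis by (intro that) (auto simp: mem_arith_prog_iff intro: order_trans)
qed

lemma exists_odd_class_off_progressions:
  assumes P: "finite P" "(\<Union>(m, a) \<in> P. arith_prog m a) \<subseteq> \<U> \<union> S" and S: "has_asymp_density S 0"
  shows "\<exists>a. odd a \<and> (\<forall>(m, c)\<in>P. \<not> [a = c] (mod m))"
proof (rule ccontr)
  assume covered: "\<not> ?thesis"
  obtain n0 where n0: "\<And>n m a. (m, a) \<in> P \<Longrightarrow> n0 \<le> n \<Longrightarrow> [n = a] (mod m) \<Longrightarrow> n \<in> arith_prog m a"
    using mem_arith_prog_if_large[OF P(1)] by blast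
  obtain n where n: "n \<ge> n0" "n \<in> romanoff_numbers" "n \<notin> S"
    using romanoff_numbers_not_density_zero[OF S] by blast
  then have "odd n" by (simp add: romanoff_numbers_def)
  then obtain m a where "(m, a) \<in> P" "[n = a] (mod m)" using covered by blast
  then have "n \<in> \<U> \<union> S" using P(2) n0 n(1) by blast
  then show False using n by (simp add: \<U>_eq)
qed

lemma exists_\<U>_off_progressions:
  assumes P: "finite P" "\<And>m c. (m, c) \<in> P \<Longrightarrow> 0 < m" and T: "has_asymp_density T 0"
    and a: "odd a" "\<And>m c. (m, c) \<in> P \<Longrightarrow> \<not> [a = c] (mod m)"
  shows "\<exists>n\<in>\<U>. n \<notin> T \<and> n \<notin> (\<Union>(m, c) \<in> P. arith_prog m c)"
proof -
  define M where "M = 2 * (\<Prod>(m, c)\<in>P. m)"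
  have "M > 0" unfolding M_def using P(2) by (auto intro!: prod_pos)
  then obtain n where n: "[n = a] (mod M)" "n \<in> \<U>" "n \<notin> T"
    using odd_progression_meets_\<U>[OF _ _ a(1) T, of M] by (auto simp: M_def)
  have "n \<notin> arith_prog m c" if mc: "(m, c) \<in> P" for m c
  proof
    assume "n \<in> arith_prog m c"
    then have "[n = c] (mod m)" by (simp add: mem_arith_prog_iff)
    moreover have "m dvd M" unfolding M_def using dvd_prodI[OF P(1) mc, of "\<lambda>(m, c). m"] by simp
    ultimately have "[a = c] (mod m)" using n(1) cong_dvd_modulus_nat cong_sym cong_trans by blast
    then show False using a(2)[OF mc] by blast
  qed
  then show ?thesis using n(2,3) by blast
qed

theorem theorem1:
  fixes S :: "nat set"
  assumes "S \<subseteq> {0<..}" and "has_asymp_density S 0"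
  shows "\<not> (\<exists>(P :: (nat \<times> nat) set) T.
      finite P \<and> (\<forall>(m, a) \<in> P. 0 < m \<and> 0 < a) \<and>
      T \<subseteq> {0<..} \<and> has_asymp_density T 0 \<and>
      \<U> \<union> S = (\<Union>(m, a) \<in> P. arith_prog m a) \<union> T)"
proof
  assume "\<exists>(P :: (nat \<times> nat) set) T. finite P \<and> (\<forall>(m, a) \<in> P. 0 < m \<and> 0 < a) \<and>
      T \<subseteq> {0<..} \<and> has_asymp_density T 0 \<and> \<U> \<union> S = (\<Union>(m, a) \<in> P. arith_prog m a) \<union> T"
  then obtain P :: "(nat \<times> nat) set" and T where P: "finite P" "\<forall>(m, a) \<in> P. 0 < m \<and> 0 < a"
    and T: "has_asymp_density T 0"
    and decomposition: "\<U> \<union> S = (\<Union>(m, a) \<in> P. arith_prog m a) \<union> T" by blast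
  have "(\<Union>(m, a) \<in> P. arith_prog m a) \<subseteq> \<U> \<union> S" unfolding decomposition by blast
  then obtain a where "odd a" "\<And>m c. (m, c) \<in> P \<Longrightarrow> \<not> [a = c] (mod m)"
    using exists_odd_class_off_progressions[OF P(1) _ assms(2)] by blast
  then obtain n where "n \<in> \<U>" "n \<notin> T" "n \<notin> (\<Union>(m, a) \<in> P. arith_prog m a)"
    using exists_\<U>_off_progressions[OF P(1) _ T] P(2) by blast
  then show False using decomposition by blast
qed

end
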